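(* Let $k\ge 0$ and let $S$ be a homology sphere of dimension $d\ge 2k-1$. Then $S$ is $k$-stellated if and only if $S$ is the boundary of a $k$-shelled $(d+1)$-ball. In consequence, all $k$-stellated spheres of dimension $\ge 2k-1$ are $k$-stacked.
   Context: Simplicial complexes are finite and contain the empty set as a face. For a finite set $\alpha$, $\overline{\alpha}$ is the complex of all subsets of $\alpha$, $\partial\alpha$ the complex of all proper subsets, and $\dim(\alpha)=\#(\alpha)-1$; $\ast$ denotes join. The standard ball $B^d_{d+1}$ is the face complex of a $d$-simplex; the standard sphere $S^d_{d+2}$ is the boundary complex of a $(d+1)$-simplex. A weak pseudomanifold is a pure $d$-dimensional complex in which each $(d-1)$-face lies in at most two facets; it is a pseudomanifold if its dual graph (facets as vertices, adjacent when meeting in a codimension-one face) is connected. Its boundary is the pure subcomplex whose facets are the $(d-1)$-faces lying in exactly one facet. Bistellar moves: let $X$ be $d$-dimensional and $\alpha,\beta$ disjoint non-empty finite sets with $\dim(\alpha)+\dim(\beta)=d$ such that the induced subcomplex of $X$ on $\alpha\sqcup\beta$ is $\overline{\alpha}\ast\partial\beta$ (if $\beta$ is a single vertex this means $\beta$ is a new vertex not in $X$). The complex $(X\setminus(\overline{\alpha}\ast\partial\beta))\cup(\partial\alpha\ast\overline{\beta})$ is obtained from $X$ by the bistellar move $\alpha\mapsto\beta$, of index $\dim(\beta)$. For $0\le k\le d+1$, a $d$-dimensional complex is $k$-stellated (a $k$-stellated sphere) if it is obtained from $S^d_{d+2}$ by a finite (possibly empty) sequence of bistellar moves each of index $<k$;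 $S^d_{d+2}$ is the only $0$-stellated one. Shelling moves: for pure $d$-dimensional complexes $X,Y$, $X$ is obtained from $Y$ by the shelling move $\alpha\leadsto\beta$ if $\alpha$ and $\beta\ne\emptyset$ are disjoint faces of $X$ such that $Y\subseteq X$, $\alpha\sqcup\beta$ is the only facet of $X$ which is not a facet of $Y$, and the induced subcomplex of $Y$ on $\alpha\sqcup\beta$ is $\overline{\alpha}\ast\partial\beta$. Its index is $\dim(\beta)$. For $0\le k\le d$, a $d$-dimensional pseudomanifold is $k$-shelled (a $k$-shelled ball) if it is obtained from $B^d_{d+1}$ by a finite (possibly empty) sequence of shelling moves each of index $<k$. A homology sphere/ball means an $\mathbb{F}$-homology sphere/ball for some field $\mathbb{F}$. An $\mathbb{F}$-homology $d$-sphere is a $d$-dimensional complex in which the link of every face $\sigma$ (including $\emptyset$) has the reduced $\mathbb{F}$-homology of a $(d-\dim(\sigma)-1)$-sphere. An $\mathbb{F}$-homology $d$-ball is a $d$-dimensional $\mathbb{F}$-acyclic complex in which the link of every non-empty face $\sigma$ has the reduced homology of a $(d-\dim(\sigma)-1)$-sphere or of a point, and whose faces with acyclic link form an $\mathbb{F}$-homology $(d-1)$-sphere (its boundary). A homology $(d+1)$-ball is $k$-stacked if all its faces of codimension at least $k+1$ (dimension $\le d-k$) lie in its boundary; a homology $d$-sphere is $k$-stacked if it is the boundary of a $k$-stacked homology $(d+1)$-ball. *)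

theory Defs
  imports "HOL-Algebra.Module" "HOL-Algebra.AbelCoset"
begin

subsection \<open>Finite simplicial complexes\<close>

text \<open>
  A complex is the set of its faces. Dimensions are integers: the empty face has dimension \<open>-1\<close>,
  and \<open>{{}}\<close> is the complex of dimension \<open>-1\<close>.
\<close>

definition simplicial_complex :: "'a set set \<Rightarrow> bool" where
  "simplicial_complex X \<longleftrightarrow>
     finite X \<and> {} \<in> X \<and> (\<forall>\<sigma>\<in>X. finite \<sigma>) \<and> (\<forall>\<sigma>\<in>X. \<forall>\<tau>. \<tau> \<subseteq> \<sigma> \<longrightarrow> \<tau> \<in> X)"

definition face_dim :: "'a set \<Rightarrow> int" where
  "face_dim \<sigma> = int (card \<sigma>) - 1"

definition complex_dim :: "'a set set \<Rightarrow> int" where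
  "complex_dim X = Max (face_dim ` X)"

definition facets :: "'a set set \<Rightarrow> 'a set set" where
  "facets X = {\<sigma> \<in> X. \<forall>\<tau>\<in>X. \<sigma> \<subseteq> \<tau> \<longrightarrow> \<tau> = \<sigma>}"

definition pure_complex :: "'a set set \<Rightarrow> bool" where
  "pure_complex X \<longleftrightarrow> simplicial_complex X \<and> (\<forall>\<sigma>\<in>facets X. face_dim \<sigma> = complex_dim X)"

definition link :: "'a set set \<Rightarrow> 'a set \<Rightarrow> 'a set set" where
  "link X \<sigma> = {\<tau>. \<tau> \<inter> \<sigma> = {} \<and> \<tau> \<union> \<sigma> \<in> X}"

definition induced :: "'a set set \<Rightarrow> 'a set \<Rightarrow> 'a set set" where
  "induced X W = {\<sigma> \<in> X. \<sigma> \<subseteq> W}"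

text \<open>\<open>Pow \<alpha>\<close> is the complex of all subsets of \<open>\<alpha>\<close>.\<close>

definition proper_subsets :: "'a set \<Rightarrow> 'a set set" where
  "proper_subsets \<alpha> = {\<sigma>. \<sigma> \<subset> \<alpha>}"

text \<open>The join is only used for complexes on disjoint vertex sets.\<close>

definition cjoin :: "'a set set \<Rightarrow> 'a set set \<Rightarrow> 'a set set" where
  "cjoin X Y = {\<sigma> \<union> \<tau> |\<sigma> \<tau>. \<sigma> \<in> X \<and> \<tau> \<in> Y}"

definition standard_ball :: "int \<Rightarrow> 'a set set \<Rightarrow> bool" where
  "standard_ball d X \<longleftrightarrow> (\<exists>V. finite V \<and> face_dim V = d \<and> X = Pow V)"

definition standard_sphere :: "int \<Rightarrow> 'a set set \<Rightarrow> bool" where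
  "standard_sphere d X \<longleftrightarrow> (\<exists>V. finite V \<and> face_dim V = d + 1 \<and> X = proper_subsets V)"


subsection \<open>Pseudomanifolds\<close>

definition weak_pseudomanifold :: "'a set set \<Rightarrow> bool" where
  "weak_pseudomanifold X \<longleftrightarrow> pure_complex X \<and>
     (\<forall>\<tau>\<in>X. face_dim \<tau> = complex_dim X - 1 \<longrightarrow> card {\<sigma> \<in> facets X. \<tau> \<subseteq> \<sigma>} \<le> 2)"

definition dual_edges :: "'a set set \<Rightarrow> ('a set \<times> 'a set) set" where
  "dual_edges X = {(\<sigma>, \<tau>). \<sigma> \<in> facets X \<and> \<tau> \<in> facets X \<and> face_dim (\<sigma> \<inter> \<tau>) = complex_dim X - 1}"

definition pseudomanifold :: "'a set set \<Rightarrow> bool" where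
  "pseudomanifold X \<longleftrightarrow> weak_pseudomanifold X \<and>
     (\<forall>\<sigma>\<in>facets X. \<forall>\<tau>\<in>facets X. (\<sigma>, \<tau>) \<in> (dual_edges X)\<^sup>*)"

text \<open>If every codimension-one face lies in two facets, this is \<open>{}\<close>, not \<open>{{}}\<close>.\<close>

definition pm_boundary :: "'a set set \<Rightarrow> 'a set set" where
  "pm_boundary X = {\<rho>. \<exists>\<tau>\<in>X. face_dim \<tau> = complex_dim X - 1
      \<and> card {\<sigma> \<in> facets X. \<tau> \<subseteq> \<sigma>} = 1 \<and> \<rho> \<subseteq> \<tau>}"


subsection \<open>Bistellar moves and shelling moves\<close>

text \<open>
  If \<open>\<beta>\<close> is a single vertex, the condition on the induced subcomplex says that this vertex is not
  in \<open>X\<close>. New vertices are taken from the type \<open>'a\<close>.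
\<close>

definition bistellar_move :: "'a set \<Rightarrow> 'a set \<Rightarrow> 'a set set \<Rightarrow> 'a set set \<Rightarrow> bool" where
  "bistellar_move \<alpha> \<beta> X Y \<longleftrightarrow>
     simplicial_complex X \<and> finite \<alpha> \<and> finite \<beta> \<and> \<alpha> \<noteq> {} \<and> \<beta> \<noteq> {} \<and> \<alpha> \<inter> \<beta> = {} \<and>
     face_dim \<alpha> + face_dim \<beta> = complex_dim X \<and>
     induced X (\<alpha> \<union> \<beta>) = cjoin (Pow \<alpha>) (proper_subsets \<beta>) \<and>
     Y = (X - cjoin (Pow \<alpha>) (proper_subsets \<beta>)) \<union> cjoin (proper_subsets \<alpha>) (Pow \<beta>)"

definition bistellar_step :: "nat \<Rightarrow> 'a set set \<Rightarrow> 'a set set \<Rightarrow> bool" where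
  "bistellar_step k X Y \<longleftrightarrow> (\<exists>\<alpha> \<beta>. bistellar_move \<alpha> \<beta> X Y \<and> face_dim \<beta> < int k)"

definition stellated :: "nat \<Rightarrow> int \<Rightarrow> 'a set set \<Rightarrow> bool" where
  "stellated k d X \<longleftrightarrow> int k \<le> d + 1 \<and> simplicial_complex X \<and> complex_dim X = d \<and>
     (\<exists>X0. standard_sphere d X0 \<and> (bistellar_step k)\<^sup>*\<^sup>* X0 X)"

text \<open>\<open>shelling_move \<alpha> \<beta> Y X\<close>: the larger complex \<open>X\<close> is obtained from \<open>Y\<close>.\<close>

definition shelling_move :: "'a set \<Rightarrow> 'a set \<Rightarrow> 'a set set \<Rightarrow> 'a set set \<Rightarrow> bool" where
  "shelling_move \<alpha> \<beta> Y X \<longleftrightarrow>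
     pure_complex X \<and> pure_complex Y \<and> complex_dim X = complex_dim Y \<and>
     \<alpha> \<in> X \<and> \<beta> \<in> X \<and> \<beta> \<noteq> {} \<and> \<alpha> \<inter> \<beta> = {} \<and> Y \<subseteq> X \<and>
     facets X - facets Y = {\<alpha> \<union> \<beta>} \<and>
     induced Y (\<alpha> \<union> \<beta>) = cjoin (Pow \<alpha>) (proper_subsets \<beta>)"

definition shelling_step :: "nat \<Rightarrow> 'a set set \<Rightarrow> 'a set set \<Rightarrow> bool" where
  "shelling_step k Y X \<longleftrightarrow> (\<exists>\<alpha> \<beta>. shelling_move \<alpha> \<beta> Y X \<and> face_dim \<beta> < int k)"

definition shelled :: "nat \<Rightarrow> int \<Rightarrow> 'a set set \<Rightarrow> bool" where
  "shelled k d X \<longleftrightarrow> int k \<le> d \<and> pseudomanifold X \<and> complex_dim X = d \<and>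
     (\<exists>X0. standard_ball d X0 \<and> (shelling_step k)\<^sup>*\<^sup>* X0 X)"


subsection \<open>Reduced simplicial homology\<close>

text \<open>
  A chain assigns a coefficient to each \<open>n\<close>-dimensional face, oriented by the linear order on the
  vertices. The empty face is the only \<open>-1\<close>-dimensional face, which makes the homology reduced.
  The \<open>mult\<close> and \<open>one\<close> fields of the module records are not used.
\<close>

definition chain_module ::
    "('f, 'm) ring_scheme \<Rightarrow> 'a set set \<Rightarrow> int \<Rightarrow> ('f, 'a set \<Rightarrow> 'f) module" where
  "chain_module F X n =
     \<lparr>carrier = {c. (\<forall>\<sigma>. c \<sigma> \<in> carrier F) \<and> (\<forall>\<sigma>. \<not> (\<sigma> \<in> X \<and> face_dim \<sigma> = n) \<longrightarrow> c \<sigma> = \<zero>\<^bsub>F\<^esub>)},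
      mult = undefined, one = undefined,
      zero = (\<lambda>\<sigma>. \<zero>\<^bsub>F\<^esub>),
      add = (\<lambda>c c' \<sigma>. c \<sigma> \<oplus>\<^bsub>F\<^esub> c' \<sigma>),
      smult = (\<lambda>a c \<sigma>. a \<otimes>\<^bsub>F\<^esub> c \<sigma>)\<rparr>"

text \<open>
  The coefficient of \<open>\<tau>\<close> in the boundary of \<open>c\<close>: removing \<open>v\<close> from \<open>insert v \<tau>\<close> has the sign
  \<open>(-1)^i\<close>, where \<open>i\<close> is the number of vertices preceding \<open>v\<close>.
\<close>

definition boundary_map ::
    "('f, 'm) ring_scheme \<Rightarrow> 'a::linorder set set \<Rightarrow> ('a set \<Rightarrow> 'f) \<Rightarrow> 'a set \<Rightarrow> 'f" where
  "boundary_map F X c \<tau> =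
     (\<Oplus>\<^bsub>F\<^esub>v\<in>{v. v \<notin> \<tau> \<and> insert v \<tau> \<in> X}.
        (\<ominus>\<^bsub>F\<^esub> \<one>\<^bsub>F\<^esub>) [^]\<^bsub>F\<^esub> card {u \<in> \<tau>. u < v} \<otimes>\<^bsub>F\<^esub> c (insert v \<tau>))"

definition cycle_module ::
    "('f, 'm) ring_scheme \<Rightarrow> 'a::linorder set set \<Rightarrow> int \<Rightarrow> ('f, 'a set \<Rightarrow> 'f) module" where
  "cycle_module F X n = (chain_module F X n)
     \<lparr>carrier := {c \<in> carrier (chain_module F X n). boundary_map F X c = (\<lambda>\<tau>. \<zero>\<^bsub>F\<^esub>)}\<rparr>"

definition boundary_chains ::
    "('f, 'm) ring_scheme \<Rightarrow> 'a::linorder set set \<Rightarrow> int \<Rightarrow> ('a set \<Rightarrow> 'f) set" where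
  "boundary_chains F X n = boundary_map F X ` carrier (chain_module F X (n + 1))"

definition homology ::
    "('f, 'm) ring_scheme \<Rightarrow> 'a::linorder set set \<Rightarrow> int \<Rightarrow> ('f, ('a set \<Rightarrow> 'f) set) module" where
  "homology F X n = (let Z = cycle_module F X n; B = boundary_chains F X n in
     \<lparr>carrier = a_rcosets\<^bsub>Z\<^esub> B,
      mult = undefined, one = undefined,
      zero = B,
      add = (\<lambda>K L. K <+>\<^bsub>Z\<^esub> L),
      smult = (\<lambda>a K. \<Union>c\<in>K. B +>\<^bsub>Z\<^esub> (a \<odot>\<^bsub>Z\<^esub> c))\<rparr>)"

definition trivial_module :: "('f, 'b) module \<Rightarrow> bool" where
  "trivial_module M \<longleftrightarrow> carrier M = {\<zero>\<^bsub>M\<^esub>}"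

definition iso_to_scalars :: "('f, 'm) ring_scheme \<Rightarrow> ('f, 'b) module \<Rightarrow> bool" where
  "iso_to_scalars F M \<longleftrightarrow> (\<exists>\<phi> \<in> iso (add_monoid M) (add_monoid F).
     \<forall>a\<in>carrier F. \<forall>x\<in>carrier M. \<phi> (a \<odot>\<^bsub>M\<^esub> x) = a \<otimes>\<^bsub>F\<^esub> \<phi> x)"

definition acyclic_complex :: "('f, 'm) ring_scheme \<Rightarrow> 'a::linorder set set \<Rightarrow> bool" where
  "acyclic_complex F X \<longleftrightarrow> (\<forall>i. trivial_module (homology F X i))"

definition sphere_homology :: "('f, 'm) ring_scheme \<Rightarrow> int \<Rightarrow> 'a::linorder set set \<Rightarrow> bool" where
  "sphere_homology F n X \<longleftrightarrow> iso_to_scalars F (homology F X n) \<and>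
     (\<forall>i. i \<noteq> n \<longrightarrow> trivial_module (homology F X i))"


subsection \<open>Homology spheres and balls, stackedness\<close>

definition homology_sphere_over :: "('f, 'm) ring_scheme \<Rightarrow> int \<Rightarrow> 'a::linorder set set \<Rightarrow> bool" where
  "homology_sphere_over F d X \<longleftrightarrow> simplicial_complex X \<and> complex_dim X = d \<and>
     (\<forall>\<sigma>\<in>X. sphere_homology F (d - face_dim \<sigma> - 1) (link X \<sigma>))"

text \<open>The empty face belongs to the boundary, since its link is the whole (acyclic) ball.\<close>

definition homology_ball_boundary :: "('f, 'm) ring_scheme \<Rightarrow> 'a::linorder set set \<Rightarrow> 'a set set" where
  "homology_ball_boundary F X = {\<sigma> \<in> X. acyclic_complex F (link X \<sigma>)}"

definition homology_ball_over :: "('f, 'm) ring_scheme \<Rightarrow> int \<Rightarrow> 'a::linorder set set \<Rightarrow> bool" where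
  "homology_ball_over F d X \<longleftrightarrow> simplicial_complex X \<and> complex_dim X = d \<and> acyclic_complex F X \<and>
     (\<forall>\<sigma>\<in>X. \<sigma> \<noteq> {} \<longrightarrow>
        sphere_homology F (d - face_dim \<sigma> - 1) (link X \<sigma>) \<or> acyclic_complex F (link X \<sigma>)) \<and>
     homology_sphere_over F (d - 1) (homology_ball_boundary F X)"

definition stacked_ball_over ::
    "('f, 'm) ring_scheme \<Rightarrow> nat \<Rightarrow> int \<Rightarrow> 'a::linorder set set \<Rightarrow> bool" where
  "stacked_ball_over F k d X \<longleftrightarrow> homology_ball_over F d X \<and>
     (\<forall>\<sigma>\<in>X. d - face_dim \<sigma> \<ge> int k + 1 \<longrightarrow> \<sigma> \<in> homology_ball_boundary F X)"

text \<open>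
  \<open>For some field\<close> cannot quantify over types, so the type \<open>'f\<close> bounding the carriers is a parameter.
  For \<open>'f = nat\<close> every prime field is available. As reduced homology commutes with extension of the
  coefficient field, nothing is lost by this choice; and a larger \<open>'f\<close> only admits more fields.
\<close>

definition homology_sphere :: "'f itself \<Rightarrow> int \<Rightarrow> 'a::linorder set set \<Rightarrow> bool" where
  "homology_sphere _ d S \<longleftrightarrow> (\<exists>F :: 'f ring. field F \<and> homology_sphere_over F d S)"

definition stacked_sphere :: "'f itself \<Rightarrow> nat \<Rightarrow> int \<Rightarrow> 'a::linorder set set \<Rightarrow> bool" where
  "stacked_sphere T k d S \<longleftrightarrow> homology_sphere T d S \<and>
     (\<exists>(F :: 'f ring) B. field F \<and> stacked_ball_over F k (d + 1) B \<and> S = homology_ball_boundary F B)"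

end

theory Submission
  imports Defs "HOL-Library.Z2" "HOL-Library.Function_Algebras"
begin

text \<open>
  Build the ball \<open>B\<close> and the sphere \<open>S = \<partial>B\<close> simultaneously: a shelling move \<open>\<alpha> \<leadsto> \<beta>\<close> on \<open>B\<close> induces
  the bistellar move \<open>\<alpha> \<mapsto> \<beta>\<close> on \<open>S\<close>. Moves of index less than \<open>k\<close> remove from the boundary only faces
  containing \<open>\<alpha>\<close>, which have codimension at most \<open>k\<close> in \<open>B\<close>, so \<open>B\<close> stays \<open>k\<close>-stacked. For \<open>d \<ge> 2 k - 1\<close>
  this lets every bistellar move on \<open>S\<close> lift: as \<open>dim \<beta> < k\<close> and \<open>\<beta> \<notin> S\<close>, also \<open>\<beta> \<notin> B\<close>. Each move glues
  one simplex to \<open>B\<close>; its effect on the links is either an elementary expansion, which preserves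
  homology, or the capping of an acyclic complex to a sphere. All homology is taken over the field
  with two elements, where orientations disappear.
\<close>

section \<open>Chains modulo 2\<close>

text \<open>Neither kind of move carries all the data needed to perform the other, and the two gaps
  are different. A bistellar move only says that \<open>\<beta>\<close> is missing from
  \<open>S\<close>. With \<open>m = d + 2\<close> the dimension bound reads
  \<open>2 * k < m\<close>, so \<open>card \<beta> + k < m\<close>, which is exactly the range where
  stackedness would force a face \<open>\<beta>\<close> of \<open>B\<close> into \<open>S\<close>. A
  shelling move only says that the new simplex meets \<open>B\<close> in the right faces, not that
  these lie on the boundary. This comes from the larger ball: a ridge of the new simplex that is
  already in \<open>B\<close> has room for at most one old facet. A further obstacle is that a
  bistellar move deletes only faces inside \<open>\<alpha> \<union> \<beta>\<close>. For an
  arbitrary complex the result need not be closed under subsets: with edges \<open>ab\<close>,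
  \<open>ac\<close>, \<open>ad\<close>, the move from \<open>a\<close> to \<open>bc\<close> deletes
  \<open>a\<close> but keeps \<open>ad\<close>. It is the homology of the link of
  \<open>\<alpha>\<close> in \<open>S\<close> that excludes this. Hence the link conditions belong
  to the induction invariant and are not merely read off at the end.\<close>

declare add_bit_eq_xor [simp del] mult_bit_eq_and [simp del]

text \<open>The sum runs over an ambient vertex set instead of the faces of a complex, so that one
  operator serves all complexes on \<open>W\<close>: a chain vanishes off its own complex. The value
  at \<open>\<tau> = {}\<close> makes the homology reduced.\<close>

definition bd :: "'a set \<Rightarrow> ('a set \<Rightarrow> bit) \<Rightarrow> 'a set \<Rightarrow> bit" where
  "bd W c \<tau> = (\<Sum>v\<in>W - \<tau>. c (insert v \<tau>))"

definition chains :: "'a set set \<Rightarrow> int \<Rightarrow> ('a set \<Rightarrow> bit) set" where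
  "chains X n = {c. \<forall>\<sigma>. c \<sigma> = 1 \<longrightarrow> \<sigma> \<in> X \<and> face_dim \<sigma> = n}"

definition cycles :: "'a set \<Rightarrow> 'a set set \<Rightarrow> int \<Rightarrow> ('a set \<Rightarrow> bit) set" where
  "cycles W X n = {c \<in> chains X n. bd W c = 0}"

definition boundaries :: "'a set \<Rightarrow> 'a set set \<Rightarrow> int \<Rightarrow> ('a set \<Rightarrow> bit) set" where
  "boundaries W X n = bd W ` chains X (n + 1)"

definition mod2_acyclic :: "'a set \<Rightarrow> 'a set set \<Rightarrow> bool" where
  "mod2_acyclic W X \<longleftrightarrow> (\<forall>n. cycles W X n \<subseteq> boundaries W X n)"

text \<open>Over two scalars, homology of dimension one means exactly two classes, those of
  \<open>0\<close> and \<open>z\<close>.\<close>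

definition mod2_sphere :: "'a set \<Rightarrow> int \<Rightarrow> 'a set set \<Rightarrow> bool" where
  "mod2_sphere W n X \<longleftrightarrow> (\<forall>i. i \<noteq> n \<longrightarrow> cycles W X i \<subseteq> boundaries W X i) \<and>
     (\<exists>z\<in>cycles W X n. z \<notin> boundaries W X n \<and>
        (\<forall>y\<in>cycles W X n. y \<in> boundaries W X n \<or> y + z \<in> boundaries W X n))"

text \<open>Unlike \<open>simplicial_complex\<close>, this admits the void complex
  \<open>{}\<close>, against which a simplex is compared in \<open>mod2_acyclic_Pow\<close>.\<close>

definition down_closed :: "'a set set \<Rightarrow> bool" where
  "down_closed X \<longleftrightarrow> (\<forall>\<sigma>\<in>X. \<forall>\<tau>\<subseteq>\<sigma>. \<tau> \<in> X)"

lemma down_closedD: "down_closed X \<Longrightarrow> \<sigma> \<in> X \<Longrightarrow> \<tau> \<subseteq> \<sigma> \<Longrightarrow> \<tau> \<in> X"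
  by (auto simp: down_closed_def)

lemma bit_add_self [simp]: "(x::bit) + x = 0"
  by (cases x) auto

lemma chain_add_self [simp]: "(c::'b \<Rightarrow> bit) + c = 0"
  by (auto simp: fun_eq_iff)

lemma chain_add_cancel [simp]: "(c::'b \<Rightarrow> bit) + (c + e) = e"
  by (simp flip: add.assoc)

lemma bit_add_eq_1_iff: "(x::bit) + y = 1 \<longleftrightarrow> (x = 1) \<noteq> (y = 1)"
  by (cases x; cases y) auto

lemma face_dim_insert: "finite \<tau> \<Longrightarrow> v \<notin> \<tau> \<Longrightarrow> face_dim (insert v \<tau>) = face_dim \<tau> + 1"
  by (simp add: face_dim_def)

lemma face_dim_remove: "finite \<tau> \<Longrightarrow> v \<in> \<tau> \<Longrightarrow> face_dim (\<tau> - {v}) = face_dim \<tau> - 1"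
  using face_dim_insert[of "\<tau> - {v}" v] by (simp add: insert_absorb)

lemma bd_add: "bd W (c + e) = bd W c + bd W e"
  by (auto simp: bd_def fun_eq_iff sum.distrib)

lemma bd_zero [simp]: "bd W 0 = 0"
  by (auto simp: bd_def fun_eq_iff)

lemma zero_in_chains [simp]: "0 \<in> chains X n"
  by (auto simp: chains_def)

lemma chains_add: "c \<in> chains X n \<Longrightarrow> e \<in> chains X n \<Longrightarrow> c + e \<in> chains X n"
  by (auto simp: chains_def bit_add_eq_1_iff)

lemma chains_mono: "Y \<subseteq> X \<Longrightarrow> chains Y n \<subseteq> chains X n"
  by (auto simp: chains_def)

lemma cycles_mono: "Y \<subseteq> X \<Longrightarrow> cycles W Y n \<subseteq> cycles W X n"
  using chains_mono[of Y X n] by (auto simp: cycles_def)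

lemma boundaries_mono: "Y \<subseteq> X \<Longrightarrow> boundaries W Y n \<subseteq> boundaries W X n"
  unfolding boundaries_def by (intro image_mono chains_mono)

lemma zero_in_cycles [simp]: "0 \<in> cycles W X n"
  by (simp add: cycles_def)

lemma cycles_add: "c \<in> cycles W X n \<Longrightarrow> e \<in> cycles W X n \<Longrightarrow> c + e \<in> cycles W X n"
  by (auto simp: cycles_def bd_add chains_add)

lemma zero_in_boundaries [simp]: "0 \<in> boundaries W X n"
  unfolding boundaries_def by (metis bd_zero image_eqI zero_in_chains)

lemma boundaries_add:
  "c \<in> boundaries W X n \<Longrightarrow> e \<in> boundaries W X n \<Longrightarrow> c + e \<in> boundaries W X n"
  unfolding boundaries_def by (auto simp flip: bd_add simp: chains_add)

text \<open>The terms for \<open>(v, w)\<close> and \<open>(w, v)\<close> cancel modulo 2. This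
  replaces the usual sign argument for \<open>bd_bd\<close>.\<close>

lemma sum_symmetric_pairs_eq_0:
  fixes f :: "'b \<Rightarrow> 'b \<Rightarrow> bit"
  assumes "finite A" "\<And>v w. f v w = f w v"
  shows "(\<Sum>v\<in>A. \<Sum>w\<in>A - {v}. f v w) = 0"
  using assms(1)
proof induction
  case (insert x A)
  have "(\<Sum>w\<in>insert x A - {v}. f v w) = f v x + (\<Sum>w\<in>A - {v}. f v w)" if "v \<in> A" for v
  proof -
    have "insert x A - {v} = insert x (A - {v})" using that insert.hyps by auto
    then show ?thesis using insert.hyps by simp
  qed
  then have "(\<Sum>v\<in>A. \<Sum>w\<in>insert x A - {v}. f v w) = (\<Sum>v\<in>A. f x v)"
    using insert.IH by (simp add: sum.distrib assms(2)[of x])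
  moreover have "insert x A - {x} = A" using insert.hyps by auto
  ultimately show ?case using insert.hyps by simp
qed simp

lemma bd_bd: assumes "finite W" shows "bd W (bd W c) = 0"
proof
  fix \<tau>
  have "bd W (bd W c) \<tau> = (\<Sum>v\<in>W - \<tau>. \<Sum>w\<in>(W - \<tau>) - {v}. c (insert w (insert v \<tau>)))"
    unfolding bd_def by (intro sum.cong refl) auto
  also have "\<dots> = 0"
    using assms by (intro sum_symmetric_pairs_eq_0) (auto simp: insert_commute)
  finally show "bd W (bd W c) \<tau> = 0 \<tau>" by simp
qed

lemma sum_bit_eq_1D: "sum f A = (1::bit) \<Longrightarrow> \<exists>x\<in>A. f x = 1"
  by (metis bit_not_zero_iff sum.neutral)

lemma bd_eq_1D: "bd W c \<tau> = 1 \<Longrightarrow> \<exists>v\<in>W - \<tau>. c (insert v \<tau>) = 1"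
  unfolding bd_def by (rule sum_bit_eq_1D)

lemma bd_in_chains:
  assumes "finite W" "X \<subseteq> Pow W" "down_closed X" "c \<in> chains X (n + 1)"
  shows "bd W c \<in> chains X n"
proof -
  have "\<tau> \<in> X \<and> face_dim \<tau> = n" if "bd W c \<tau> = 1" for \<tau>
  proof -
    from bd_eq_1D[OF that] obtain v where v: "v \<in> W" "v \<notin> \<tau>" "c (insert v \<tau>) = 1" by auto
    then have "insert v \<tau> \<in> X" "face_dim (insert v \<tau>) = n + 1"
      using assms(4) by (auto simp: chains_def)
    moreover have "finite \<tau>"
      using calculation(1) assms(1,2) by (meson PowD finite_insert finite_subset subsetD)
    ultimately show ?thesis
      using down_closedD[OF assms(3), of "insert v \<tau>" \<tau>] face_dim_insert[of \<tau> v] v by auto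
  qed
  then show ?thesis by (simp add: chains_def)
qed

section \<open>Gluing\<close>

text \<open>The cone operator with apex \<open>v\<close> is a contraction of the relative chain complex.\<close>

lemma push_off_matched_faces:
  assumes W: "finite W" "X \<subseteq> Pow W" "v \<in> W" and X: "down_closed X"
    and Y: "down_closed Y" "Y \<subseteq> X"
    and match: "\<And>\<sigma>. insert v \<sigma> \<in> X - Y \<longleftrightarrow> \<sigma> - {v} \<in> X - Y"
    and c: "c \<in> chains X n" "\<And>\<tau>. \<tau> \<in> X - Y \<Longrightarrow> bd W c \<tau> = 0"
  shows "\<exists>e\<in>chains X (n + 1). c + bd W e \<in> chains Y n"
proof
  \<comment> \<open>The cone with apex \<open>v\<close> over the part of \<open>c\<close> outside
    \<open>Y\<close>, keeping only faces outside \<open>Y\<close>.\<close>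
  define e where "e = (\<lambda>\<rho>. if v \<in> \<rho> \<and> \<rho> \<in> X - Y then c (\<rho> - {v}) else 0)"
  have fin: "finite \<sigma>" if "\<sigma> \<in> X" for \<sigma> using W that by (meson PowD finite_subset subsetD)
  show e: "e \<in> chains X (n + 1)"
    unfolding chains_def
  proof safe
    fix \<rho> assume "e \<rho> = 1"
    then have *: "v \<in> \<rho>" "\<rho> \<in> X" "c (\<rho> - {v}) = 1" by (auto simp: e_def split: if_splits)
    then show "\<rho> \<in> X" by simp
    from * c(1) have "face_dim (\<rho> - {v}) = n" by (auto simp: chains_def)
    then show "face_dim \<rho> = n + 1" using face_dim_remove[OF fin, of \<rho> v] * by simp
  qed
  \<comment> \<open>The cone formula: the boundary of \<open>v * c\<close> is \<open>c\<close> plus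
    \<open>v\<close> times the boundary of \<open>c\<close>, and the second term vanishes because
    \<open>c\<close> is a cycle relative to \<open>Y\<close>. On faces without \<open>v\<close> only
    the summand \<open>w = v\<close> survives. On a face \<open>insert v \<rho>\<close> the claim is
    the relative cycle condition at \<open>\<rho>\<close>.\<close>
  have agree: "bd W e \<tau> = c \<tau>" if \<tau>: "\<tau> \<in> X - Y" for \<tau>
  proof (cases "v \<in> \<tau>")
    case False
    have "bd W e \<tau> = (\<Sum>w\<in>W - \<tau>. if w = v then c \<tau> else 0)"
      unfolding bd_def
    proof (intro sum.cong refl)
      fix w assume "w \<in> W - \<tau>"
      have "insert v \<tau> \<in> X - Y" using match[of \<tau>] \<tau> False by simp
      then show "e (insert w \<tau>) = (if w = v then c \<tau> else 0)"
        using False by (auto simp: e_def)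
    qed
    also have "\<dots> = c \<tau>" using W False by simp
    finally show ?thesis .
  next
    case True
    define \<rho> where "\<rho> = \<tau> - {v}"
    have \<rho>: "\<rho> \<in> X - Y" "\<tau> = insert v \<rho>" "v \<notin> \<rho>"
      using match[of \<tau>] \<tau> True by (auto simp: \<rho>_def insert_absorb)
    have "bd W e \<tau> = (\<Sum>w\<in>W - \<tau>. c (insert w \<rho>))"
      unfolding bd_def
    proof (intro sum.cong refl)
      fix w assume w: "w \<in> W - \<tau>"
      have eq: "insert w \<tau> - {v} = insert w \<rho>" using w \<rho> by auto
      have "insert w \<rho> \<in> X - Y" if "c (insert w \<rho>) = 1"
        using that c(1) \<rho>(1) down_closedD[OF Y(1), of "insert w \<rho>" \<rho>] by (auto simp: chains_def)
      then have "insert w \<tau> \<in> X - Y" if "c (insert w \<rho>) = 1"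
        using match[of "insert w \<tau>"] that True by (simp add: eq insert_absorb)
      then show "e (insert w \<tau>) = c (insert w \<rho>)"
        using True unfolding e_def eq by (cases "c (insert w \<rho>)") auto
    qed
    moreover have "bd W c \<rho> = c \<tau> + (\<Sum>w\<in>W - \<tau>. c (insert w \<rho>))"
    proof -
      have "W - \<rho> = insert v (W - \<tau>)" using \<rho> W by auto
      then have "bd W c \<rho> = (\<Sum>w\<in>insert v (W - \<tau>). c (insert w \<rho>))" by (simp only: bd_def)
      also have "\<dots> = c (insert v \<rho>) + (\<Sum>w\<in>W - \<tau>. c (insert w \<rho>))"
        using W True by (intro sum.insert) auto
      finally show ?thesis unfolding \<rho>(2) .
    qed
    moreover have "bd W c \<rho> = 0" using c(2) \<rho> by simp
    ultimately show ?thesis by (cases "c \<tau>"; cases "bd W e \<tau>") auto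
  qed
  have "bd W e \<in> chains X n" by (rule bd_in_chains) (use W X e in auto)
  then have X': "c + bd W e \<in> chains X n" using c(1) chains_add by blast
  have "\<sigma> \<in> Y" if "(c + bd W e) \<sigma> = 1" for \<sigma>
  proof (rule ccontr)
    assume "\<sigma> \<notin> Y"
    then have "bd W e \<sigma> = c \<sigma>" using agree that X' unfolding chains_def by blast
    then show False using that by simp
  qed
  with X' show "c + bd W e \<in> chains Y n"
    unfolding chains_def by blast
qed

text \<open>The faces of \<open>X\<close> outside \<open>Y\<close> come in pairs that differ only in
  \<open>v\<close>, so the inclusion of \<open>Y\<close> induces an isomorphism on homology. In the
  proof, \<open>A\<close> is its surjectivity and \<open>B\<close> its injectivity; the rest
  transports the two notions along it.\<close>

lemma matched_faces_homology:
  assumes W: "finite W" "X \<subseteq> Pow W" "v \<in> W" and X: "down_closed X"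
    and Y: "down_closed Y" "Y \<subseteq> X"
    and match: "\<And>\<sigma>. insert v \<sigma> \<in> X - Y \<longleftrightarrow> \<sigma> - {v} \<in> X - Y"
  shows "mod2_acyclic W Y \<longleftrightarrow> mod2_acyclic W X" and "mod2_sphere W n Y \<longleftrightarrow> mod2_sphere W n X"
proof -
  have A: "\<exists>y\<in>cycles W Y i. z + y \<in> boundaries W X i" if z: "z \<in> cycles W X i" for z i
  proof -
    from z obtain e where e: "e \<in> chains X (i + 1)" "z + bd W e \<in> chains Y i"
      using push_off_matched_faces[OF assms, of z i] by (auto simp: cycles_def)
    have "bd W (z + bd W e) = 0" using z bd_bd[OF W(1)] by (simp add: bd_add cycles_def)
    then have "z + bd W e \<in> cycles W Y i" using e by (simp add: cycles_def)
    moreover have "z + (z + bd W e) \<in> boundaries W X i" using e by (simp add: boundaries_def)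
    ultimately show ?thesis by blast
  qed
  have B: "y \<in> boundaries W Y i" if y: "y \<in> cycles W Y i" "y \<in> boundaries W X i" for y i
  proof -
    from y obtain c where c: "c \<in> chains X (i + 1)" "y = bd W c" by (auto simp: boundaries_def)
    have "bd W c \<tau> = 0" if "\<tau> \<in> X - Y" for \<tau>
    proof (rule ccontr)
      assume "bd W c \<tau> \<noteq> 0"
      then have "y \<tau> = 1" using c by simp
      then show False using y(1) that by (auto simp: cycles_def chains_def)
    qed
    then obtain e where e: "c + bd W e \<in> chains Y (i + 1)"
      using push_off_matched_faces[OF assms c(1)] by auto
    have "y = bd W (c + bd W e)" using c bd_bd[OF W(1)] by (simp add: bd_add)
    then show ?thesis using e by (auto simp: boundaries_def)
  qed
  have triv: "cycles W Y i \<subseteq> boundaries W Y i \<longleftrightarrow> cycles W X i \<subseteq> boundaries W X i" for i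
  proof
    assume *: "cycles W Y i \<subseteq> boundaries W Y i"
    show "cycles W X i \<subseteq> boundaries W X i"
    proof
      fix z assume "z \<in> cycles W X i"
      then obtain y where y: "y \<in> cycles W Y i" "z + y \<in> boundaries W X i" using A by blast
      then have "y \<in> boundaries W X i" using * boundaries_mono[OF Y(2)] by blast
      then have "y + (z + y) \<in> boundaries W X i" using y boundaries_add by blast
      then show "z \<in> boundaries W X i" by (simp add: add.left_commute add.commute)
    qed
  next
    assume "cycles W X i \<subseteq> boundaries W X i"
    then show "cycles W Y i \<subseteq> boundaries W Y i" using B cycles_mono[OF Y(2)] by blast
  qed
  then show "mod2_acyclic W Y \<longleftrightarrow> mod2_acyclic W X" by (simp add: mod2_acyclic_def)
  show "mod2_sphere W n Y \<longleftrightarrow> mod2_sphere W n X"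
    unfolding mod2_sphere_def triv
  proof (intro conj_cong refl iffI; elim bexE conjE)
    fix z assume z: "z \<in> cycles W Y n" "z \<notin> boundaries W Y n"
      "\<forall>y\<in>cycles W Y n. y \<in> boundaries W Y n \<or> y + z \<in> boundaries W Y n"
    have "y \<in> boundaries W X n \<or> y + z \<in> boundaries W X n" if y: "y \<in> cycles W X n" for y
    proof -
      obtain y' where y': "y' \<in> cycles W Y n" "y + y' \<in> boundaries W X n" using A[OF y] by blast
      from z y' have "y' \<in> boundaries W X n \<or> y' + z \<in> boundaries W X n"
        using boundaries_mono[OF Y(2)] by blast
      then have "(y + y') + y' \<in> boundaries W X n \<or> (y + y') + (y' + z) \<in> boundaries W X n"
        using y' boundaries_add by blast
      then show ?thesis by (simp add: add.assoc)
    qed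
    then show "\<exists>z\<in>cycles W X n. z \<notin> boundaries W X n \<and>
        (\<forall>y\<in>cycles W X n. y \<in> boundaries W X n \<or> y + z \<in> boundaries W X n)"
      using z B cycles_mono[OF Y(2)] by (metis subsetD)
  next
    fix z assume z: "z \<in> cycles W X n" "z \<notin> boundaries W X n"
      "\<forall>y\<in>cycles W X n. y \<in> boundaries W X n \<or> y + z \<in> boundaries W X n"
    obtain z' where z': "z' \<in> cycles W Y n" "z + z' \<in> boundaries W X n" using A[OF z(1)] by blast
    have "z' \<notin> boundaries W Y n"
    proof
      assume "z' \<in> boundaries W Y n"
      then have "z' \<in> boundaries W X n" using boundaries_mono[OF Y(2)] by blast
      then have "(z + z') + z' \<in> boundaries W X n" using z' boundaries_add by blast
      then show False using z by (simp add: add.assoc)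
    qed
    moreover have "y \<in> boundaries W Y n \<or> y + z' \<in> boundaries W Y n" if y: "y \<in> cycles W Y n" for y
    proof (cases "y \<in> boundaries W X n")
      case False
      then have "y + z \<in> boundaries W X n" using z(3) y cycles_mono[OF Y(2)] by blast
      then have "(y + z) + (z + z') \<in> boundaries W X n" using z' boundaries_add by blast
      then have "y + z' \<in> boundaries W X n" by (simp add: add.assoc)
      then show ?thesis using B cycles_add[OF y z'(1)] by blast
    qed (use B y in blast)
    ultimately show "\<exists>z\<in>cycles W Y n. z \<notin> boundaries W Y n \<and>
        (\<forall>y\<in>cycles W Y n. y \<in> boundaries W Y n \<or> y + z \<in> boundaries W Y n)"
      using z' by blast
  qed
qed

text \<open>Adding and removing one vertex pairs off all faces of a simplex, so it compares with the
  void complex. For \<open>V = {}\<close> there is no such vertex, and \<open>{{}}\<close> is the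
  sphere of dimension -1.\<close>

lemma mod2_acyclic_Pow:
  assumes "finite W" "V \<subseteq> W" "V \<noteq> {}"
  shows "mod2_acyclic W (Pow V)"
proof -
  obtain v where v: "v \<in> V" using assms by blast
  have "mod2_acyclic W {} \<longleftrightarrow> mod2_acyclic W (Pow V)"
    by (rule matched_faces_homology(1)[where v = v]) (use assms v in \<open>auto simp: down_closed_def\<close>)
  moreover have "c = 0" if "c \<in> chains {} n" for c :: "'a set \<Rightarrow> bit" and n
    using that by (auto simp: chains_def fun_eq_iff)
  then have "cycles W {} n \<subseteq> {0}" for n by (auto simp: cycles_def)
  then have "mod2_acyclic W {}" unfolding mod2_acyclic_def
    by (metis subset_singletonD empty_subsetI zero_in_boundaries insert_subset)
  ultimately show ?thesis by simp
qed

section \<open>Fundamental cycles: capping an acyclic complex, and boundaries of simplices\<close>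

definition single :: "'a set \<Rightarrow> 'a set \<Rightarrow> bit" where
  "single b = (\<lambda>\<sigma>. of_bool (\<sigma> = b))"

lemma single_in_chains: "b \<in> X \<Longrightarrow> single b \<in> chains X (face_dim b)"
  by (auto simp: chains_def single_def)

lemma bd_single_facet:
  assumes "finite W" "b \<subseteq> W" "v \<in> b"
  shows "bd W (single b) (b - {v}) = 1"
proof -
  have "bd W (single b) (b - {v}) = (\<Sum>w\<in>W - (b - {v}). if w = v then 1 else 0)"
    unfolding bd_def
  proof (intro sum.cong refl)
    fix w assume "w \<in> W - (b - {v})"
    then have "insert w (b - {v}) = b \<longleftrightarrow> w = v" using assms(3) by auto
    then show "single b (insert w (b - {v})) = (if w = v then 1 else 0)" by (simp add: single_def)
  qed
  also have "\<dots> = 1" using assms by auto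
  finally show ?thesis .
qed

lemma bd_single_eq_1D: "bd W (single b) \<tau> = 1 \<Longrightarrow> \<exists>v. v \<notin> \<tau> \<and> b = insert v \<tau>"
  by (drule bd_eq_1D) (auto simp: single_def split: if_splits)

text \<open>The boundary of \<open>b\<close> is a cycle of the acyclic complex \<open>X\<close>,
  hence bounds some \<open>c\<close> there, and \<open>z = single b + c\<close> generates the
  homology. Cycles with coefficient 0 at \<open>b\<close> lie in \<open>X\<close> and bound; for the
  others adding \<open>z\<close> removes the coefficient. As \<open>b\<close> is in no larger face,
  no boundary of top degree involves \<open>b\<close>, so \<open>z\<close> itself does not
  bound.\<close>

lemma mod2_sphere_insert_face:
  assumes W: "finite W" "insert b X \<subseteq> Pow W" and X: "down_closed X" "mod2_acyclic W X"
    and b: "b \<notin> X" "b \<noteq> {}" "proper_subsets b \<subseteq> X"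
  shows "mod2_sphere W (face_dim b) (insert b X)"
proof -
  have chD: "c \<in> chains X n" if "c \<in> chains (insert b X) n" "c b = 0" for c n
    unfolding chains_def
  proof safe
    fix \<sigma> assume "c \<sigma> = 1"
    then show "\<sigma> \<in> X" "face_dim \<sigma> = n" using that by (auto simp: chains_def)
  qed
  have dX: "down_closed (insert b X)"
    using X b by (auto simp: down_closed_def proper_subsets_def)
  have finb: "finite b" using W by (meson PowD finite_subset insert_subset)
  have bd_b: "bd W (single b) \<in> cycles W X (face_dim b - 1)"
  proof -
    have "\<tau> \<in> X" if "bd W (single b) \<tau> = 1" for \<tau>
      using bd_single_eq_1D[OF that] b by (auto simp: proper_subsets_def)
    moreover have "bd W (single b) \<in> chains (insert b X) (face_dim b - 1)"
      by (rule bd_in_chains) (use W dX in \<open>auto intro: single_in_chains\<close>)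
    ultimately show ?thesis using bd_bd[OF W(1)] by (auto simp: cycles_def chains_def)
  qed
  then obtain c where c: "c \<in> chains X (face_dim b)" "bd W c = bd W (single b)"
    using X(2) unfolding mod2_acyclic_def boundaries_def by fastforce
  define z where "z = single b + c"
  have cb: "c b = 0" if "c \<in> chains X n" for c n
    using that b by (auto simp: chains_def)
  have z: "z \<in> cycles W (insert b X) (face_dim b)"
    using c chains_mono[of X "insert b X"] single_in_chains[of b "insert b X"]
    by (auto simp: z_def cycles_def bd_add intro!: chains_add)
  have zb: "z b = 1" using cb[OF c(1)] by (simp add: z_def single_def)
  have triv: "y \<in> boundaries W (insert b X) n" if "y \<in> cycles W (insert b X) n" "y b = 0" for y n
  proof -
    have "y \<in> cycles W X n" using that chD by (auto simp: cycles_def)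
    then show ?thesis using X(2) boundaries_mono[of X "insert b X", OF subset_insertI]
      unfolding mod2_acyclic_def by blast
  qed
  show ?thesis
    unfolding mod2_sphere_def
  proof (intro conjI allI impI bexI[of _ z])
    fix i assume i: "i \<noteq> face_dim b"
    show "cycles W (insert b X) i \<subseteq> boundaries W (insert b X) i"
    proof
      fix y assume y: "y \<in> cycles W (insert b X) i"
      then have "y b = 0" using i by (auto simp: cycles_def chains_def)
      with y show "y \<in> boundaries W (insert b X) i" by (rule triv)
    qed
  next
    show "z \<notin> boundaries W (insert b X) (face_dim b)"
    proof
      assume "z \<in> boundaries W (insert b X) (face_dim b)"
      then obtain e where e: "e \<in> chains (insert b X) (face_dim b + 1)" "z = bd W e"
        by (auto simp: boundaries_def)
      have "e b = 0" using e by (auto simp: chains_def)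
      then have "e \<in> chains X (face_dim b + 1)" using e chD by blast
      then have "z \<in> chains X (face_dim b)"
        using bd_in_chains[of W X] W X e by auto
      then show False using zb cb by (metis zero_neq_one)
    qed
  next
    show "\<forall>y\<in>cycles W (insert b X) (face_dim b). y \<in> boundaries W (insert b X) (face_dim b) \<or>
        y + z \<in> boundaries W (insert b X) (face_dim b)"
    proof
      fix y assume y: "y \<in> cycles W (insert b X) (face_dim b)"
      show "y \<in> boundaries W (insert b X) (face_dim b) \<or>
        y + z \<in> boundaries W (insert b X) (face_dim b)"
      proof (cases "y b = 1")
        case True
        then have "(y + z) b = 0" using zb by simp
        then show ?thesis using triv[OF cycles_add[OF y z]] by blast
      next
        case False
        then show ?thesis using triv[OF y] by simp
      qed
    qed
  qed (rule z)
qed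

text \<open>Every cycle bounds a chain in the full simplex. Outside the top degree this chain cannot
  involve \<open>b\<close>; in the top degree it is \<open>0\<close> or \<open>single b\<close>,
  which leaves the boundary of \<open>b\<close> as the only nonzero class. A single vertex
  \<open>b\<close> gives \<open>{{}}\<close>, the sphere of dimension -1.\<close>

lemma mod2_sphere_proper_subsets:
  assumes W: "finite W" "b \<subseteq> W" and b: "b \<noteq> {}"
  shows "mod2_sphere W (face_dim b - 1) (proper_subsets b)"
proof -
  have fin: "finite b" using W finite_subset by blast
  have dc: "down_closed (proper_subsets b)" by (auto simp: down_closed_def proper_subsets_def)
  have sub: "proper_subsets b \<subseteq> Pow W" using W by (auto simp: proper_subsets_def)
  obtain v where v: "v \<in> b" using b by blast
  have lt: "face_dim \<sigma> < face_dim b" if "\<sigma> \<subset> b" for \<sigma>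
    using psubset_card_mono[OF fin that] by (simp add: face_dim_def)
  have dim: "c = 0" if c: "c \<in> chains (proper_subsets b) n" "n \<ge> face_dim b" for c n
  proof
    fix \<sigma> show "c \<sigma> = 0 \<sigma>"
      using c lt[of \<sigma>] by (cases "c \<sigma>") (auto simp: chains_def proper_subsets_def)
  qed
  have top: "c = 0 \<or> c = single b" if c: "c \<in> chains (Pow b) (face_dim b)" for c
  proof -
    have *: "c \<sigma> = 0" if "\<sigma> \<noteq> b" for \<sigma>
      using c lt[of \<sigma>] that by (cases "c \<sigma>") (auto simp: chains_def)
    show ?thesis
    proof (cases "c b = 0")
      case True
      then have "c \<sigma> = 0" for \<sigma> using * by (cases "\<sigma> = b") auto
      then show ?thesis by (auto simp: fun_eq_iff)
    next
      case False
      then show ?thesis using * by (auto simp: single_def fun_eq_iff)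
    qed
  qed
  have ac: "mod2_acyclic W (Pow b)" by (rule mod2_acyclic_Pow) (use assms in auto)
  define z where "z = bd W (single b)"
  have z1: "z (b - {v}) = 1" unfolding z_def by (rule bd_single_facet) (use W v in auto)
  have z: "z \<in> cycles W (proper_subsets b) (face_dim b - 1)"
  proof -
    have "\<tau> \<in> proper_subsets b" if "z \<tau> = 1" for \<tau>
      using bd_single_eq_1D[of W b \<tau>] that by (auto simp: proper_subsets_def z_def)
    moreover have "z \<in> chains (Pow b) (face_dim b - 1)"
      unfolding z_def by (rule bd_in_chains)
        (use W in \<open>auto intro: single_in_chains simp: down_closed_def\<close>)
    ultimately show ?thesis using bd_bd[OF W(1)] by (auto simp: cycles_def chains_def z_def)
  qed
  have lift: "\<exists>c\<in>chains (Pow b) (i + 1). y = bd W c" if "y \<in> cycles W (proper_subsets b) i" for y i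
  proof -
    have "y \<in> cycles W (Pow b) i"
      using that cycles_mono[of "proper_subsets b" "Pow b"] by (auto simp: proper_subsets_def)
    then show ?thesis using ac by (auto simp: mod2_acyclic_def boundaries_def)
  qed
  show ?thesis
    unfolding mod2_sphere_def
  proof (intro conjI allI impI bexI[of _ z] ballI)
    fix i assume i: "i \<noteq> face_dim b - 1"
    show "cycles W (proper_subsets b) i \<subseteq> boundaries W (proper_subsets b) i"
    proof
      fix y assume "y \<in> cycles W (proper_subsets b) i"
      then obtain c where c: "c \<in> chains (Pow b) (i + 1)" "y = bd W c" using lift by blast
      then have "c \<in> chains (proper_subsets b) (i + 1)"
        using i by (auto simp: chains_def proper_subsets_def)
      then show "y \<in> boundaries W (proper_subsets b) i" using c by (auto simp: boundaries_def)
    qed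
  next
    show "z \<notin> boundaries W (proper_subsets b) (face_dim b - 1)"
    proof
      assume "z \<in> boundaries W (proper_subsets b) (face_dim b - 1)"
      then obtain c where "c \<in> chains (proper_subsets b) (face_dim b)" "z = bd W c"
        by (auto simp: boundaries_def)
      then have "z = 0" using dim[of c "face_dim b"] by simp
      then show False using z1 by simp
    qed
  next
    fix y assume "y \<in> cycles W (proper_subsets b) (face_dim b - 1)"
    then obtain c where "c \<in> chains (Pow b) (face_dim b)" "y = bd W c" using lift by force
    then have "y = 0 \<or> y = z" using top[of c] by (auto simp: z_def)
    then show "y \<in> boundaries W (proper_subsets b) (face_dim b - 1) \<or>
        y + z \<in> boundaries W (proper_subsets b) (face_dim b - 1)" by auto
  qed (rule z)
qed

section \<open>Homology over the field with two elements\<close>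

text \<open>The carrier sits in \<open>nat\<close> because the statement asks for stackedness over
  \<open>TYPE(nat)\<close>. Since -1 equals 1 here, the signs in \<open>boundary_map\<close> become
  1.\<close>

definition F2 :: "nat ring" where
  "F2 = \<lparr>carrier = {0, 1}, mult = (*), one = 1, zero = 0, add = (\<lambda>x y. (x + y) mod 2)\<rparr>"

lemma F2_simps [simp]:
  "carrier F2 = {0, 1}" "\<one>\<^bsub>F2\<^esub> = 1" "\<zero>\<^bsub>F2\<^esub> = 0"
  "x \<otimes>\<^bsub>F2\<^esub> y = x * y" "x \<oplus>\<^bsub>F2\<^esub> y = (x + y) mod 2"
  by (simp_all add: F2_def)

lemma field_F2: "field F2"
proof -
  have "cring F2"
  proof (intro cringI abelian_groupI comm_monoidI)
    fix x assume "x \<in> carrier F2"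
    then show "\<exists>y\<in>carrier F2. y \<oplus>\<^bsub>F2\<^esub> x = \<zero>\<^bsub>F2\<^esub>"
      by (intro bexI[of _ x]) auto
  qed auto
  moreover have "Units F2 = {1}" by (auto simp: Units_def)
  ultimately show ?thesis by (intro cring.cring_fieldI) auto
qed

lemma a_inv_one_F2 [simp]: "\<ominus>\<^bsub>F2\<^esub> (Suc 0) = Suc 0"
proof -
  interpret field F2 by (rule field_F2)
  have "\<ominus>\<^bsub>F2\<^esub> (Suc 0) \<oplus>\<^bsub>F2\<^esub> Suc 0 = 0" using l_neg[of "Suc 0"] by simp
  moreover have "\<ominus>\<^bsub>F2\<^esub> (Suc 0) \<in> {0, 1}" using a_inv_closed[of "Suc 0"] by simp
  ultimately show ?thesis by auto
qed

lemma one_pow_F2 [simp]: "Suc 0 [^]\<^bsub>F2\<^esub> (n::nat) = Suc 0"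
proof -
  interpret field F2 by (rule field_F2)
  show ?thesis using nat_pow_one[of n] by simp
qed

text \<open>Links the two arithmetics: computations use the type class operations on
  \<open>bit\<close>, while the homology modules are built on the record \<open>F2\<close>.\<close>

definition emb :: "bit \<Rightarrow> nat" where
  "emb x = (if x = 0 then 0 else 1)"

lemma emb_simps [simp]: "emb 0 = 0" "emb 1 = 1" "emb x = emb y \<longleftrightarrow> x = y" "emb x = 0 \<longleftrightarrow> x = 0"
  by (cases x; cases y; simp add: emb_def)+

lemma emb_add: "emb (x + y) = (emb x + emb y) mod 2"
  by (cases x; cases y) (simp_all add: emb_def)

lemma emb_in_F2: "emb x \<in> {0, Suc 0}"
  by (simp add: emb_def)

lemma emb_sum: "finite A \<Longrightarrow> finsum F2 (\<lambda>v. emb (g v)) A = emb (sum g A)"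
proof (induction rule: finite_induct)
  interpret field F2 by (rule field_F2)
  case empty
  then show ?case using finsum_empty by simp
next
  interpret field F2 by (rule field_F2)
  case (insert x A)
  then show ?case
    using emb_in_F2 by (subst finsum_insert) (auto simp: emb_add)
qed

definition embc :: "('a set \<Rightarrow> bit) \<Rightarrow> 'a set \<Rightarrow> nat" where
  "embc c = (\<lambda>\<sigma>. emb (c \<sigma>))"

lemma inj_embc: "inj embc"
  by (auto simp: inj_def embc_def fun_eq_iff)

lemma embc_eq_iff [simp]: "embc c = embc e \<longleftrightarrow> c = e"
  using inj_embc by (auto simp: inj_def)

lemma embc_zero: "embc 0 = (\<lambda>\<sigma>. 0)"
  by (simp add: embc_def)

lemma embc_add: "(\<lambda>\<sigma>. (embc c \<sigma> + embc e \<sigma>) mod 2) = embc (c + e)"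
  by (simp add: embc_def emb_add)

lemma carrier_chain_module_F2: "carrier (chain_module F2 X n) = embc ` chains X n"
proof (intro equalityI subsetI)
  fix c assume c: "c \<in> carrier (chain_module F2 X n)"
  define e :: "'a set \<Rightarrow> bit" where "e = (\<lambda>\<sigma>. of_nat (c \<sigma>))"
  have c01: "c \<sigma> \<in> {0, 1}" "\<not> (\<sigma> \<in> X \<and> face_dim \<sigma> = n) \<Longrightarrow> c \<sigma> = 0" for \<sigma>
    using c by (auto simp: chain_module_def)
  have "emb (e \<sigma>) = c \<sigma>" for \<sigma> using c01(1)[of \<sigma>] by (auto simp: e_def)
  then have "c = embc e" by (simp add: embc_def)
  moreover have "e \<in> chains X n" using c01(2) by (fastforce simp: chains_def e_def)
  ultimately show "c \<in> embc ` chains X n" by blast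
next
  fix c assume "c \<in> embc ` chains X n"
  then obtain e where "c = embc e" "e \<in> chains X n" by blast
  moreover have "emb (e \<sigma>) \<in> {0, 1}" for \<sigma> using emb_in_F2 by simp
  ultimately show "c \<in> carrier (chain_module F2 X n)"
    by (fastforce simp: chain_module_def chains_def embc_def)
qed

lemma boundary_map_F2:
  assumes W: "finite W" "X \<subseteq> Pow W" and c: "c \<in> chains X n"
  shows "boundary_map F2 X (embc c) = embc (bd W c)"
proof
  fix \<tau>
  let ?A = "{v. v \<notin> \<tau> \<and> insert v \<tau> \<in> X}"
  have sub: "?A \<subseteq> W - \<tau>" using W by auto
  have "boundary_map F2 X (embc c) \<tau> = finsum F2 (\<lambda>v. emb (c (insert v \<tau>))) ?A"
    by (simp add: boundary_map_def embc_def)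
  also have "\<dots> = emb (\<Sum>v\<in>?A. c (insert v \<tau>))"
    by (rule emb_sum) (use W sub in \<open>auto intro: finite_subset\<close>)
  also have "(\<Sum>v\<in>?A. c (insert v \<tau>)) = bd W c \<tau>"
    unfolding bd_def
  proof (rule sum.mono_neutral_left)
    show "\<forall>v\<in>W - \<tau> - ?A. c (insert v \<tau>) = 0" using c by (auto simp: chains_def)
  qed (use W sub in auto)
  finally show "boundary_map F2 X (embc c) \<tau> = embc (bd W c) \<tau>" by (simp add: embc_def)
qed

context
  fixes W :: "'a::linorder set" and X :: "'a set set"
  assumes W: "finite W" "X \<subseteq> Pow W" and X: "down_closed X"
begin

lemma carrier_cycle_module_F2: "carrier (cycle_module F2 X n) = embc ` cycles W X n"
proof -
  have "carrier (cycle_module F2 X n) =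
      {c \<in> embc ` chains X n. boundary_map F2 X c = embc 0}"
    by (simp add: cycle_module_def carrier_chain_module_F2 embc_zero)
  also have "\<dots> = embc ` cycles W X n"
    using boundary_map_F2[OF W] by (auto simp: cycles_def)
  finally show ?thesis .
qed

lemma boundary_chains_F2: "boundary_chains F2 X n = embc ` boundaries W X n"
  using boundary_map_F2[OF W]
  by (auto simp: boundary_chains_def boundaries_def carrier_chain_module_F2 image_image)

text \<open>The homology class of \<open>z\<close>: in characteristic 2 the difference
  \<open>y - z\<close> is \<open>y + z\<close>.\<close>

definition coset :: "int \<Rightarrow> ('a set \<Rightarrow> bit) \<Rightarrow> ('a set \<Rightarrow> nat) set" where
  "coset n z = embc ` {y. y + z \<in> boundaries W X n}"

lemma coset_altdef: "coset n z = (\<lambda>b. embc (b + z)) ` boundaries W X n"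
proof -
  have "{y. y + z \<in> boundaries W X n} = (\<lambda>b. b + z) ` boundaries W X n"
  proof (intro equalityI subsetI)
    fix y assume "y \<in> {y. y + z \<in> boundaries W X n}"
    moreover have "y = (y + z) + z" by (simp add: add.assoc)
    ultimately show "y \<in> (\<lambda>b. b + z) ` boundaries W X n" by blast
  qed (auto simp: add.assoc)
  then show ?thesis by (auto simp: coset_def)
qed

lemma carrier_homology_F2: "carrier (homology F2 X n) = coset n ` cycles W X n"
proof -
  have "boundary_chains F2 X n #>\<^bsub>add_monoid (cycle_module F2 X n)\<^esub> embc z = coset n z" for z
    by (auto simp: r_coset_def boundary_chains_F2 coset_altdef cycle_module_def chain_module_def
        embc_add)
  then show ?thesis
    by (auto simp: homology_def Let_def A_RCOSETS_def RCOSETS_def carrier_cycle_module_F2)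
qed

lemma zero_homology_F2: "\<zero>\<^bsub>homology F2 X n\<^esub> = coset n 0"
  by (simp add: homology_def Let_def boundary_chains_F2 coset_def)

lemma coset_eq_iff: "coset n y = coset n z \<longleftrightarrow> y + z \<in> boundaries W X n"
proof -
  have "coset n y = coset n z \<longleftrightarrow>
      (\<forall>x. x + y \<in> boundaries W X n \<longleftrightarrow> x + z \<in> boundaries W X n)"
    unfolding coset_def inj_image_eq_iff[OF inj_embc] by blast
  also have "\<dots> \<longleftrightarrow> y + z \<in> boundaries W X n"
  proof
    assume "\<forall>x. x + y \<in> boundaries W X n \<longleftrightarrow> x + z \<in> boundaries W X n"
    then show "y + z \<in> boundaries W X n" by (metis chain_add_self zero_in_boundaries)
  next
    assume yz: "y + z \<in> boundaries W X n"
    have "x + y = (x + z) + (y + z)" "x + z = (x + y) + (y + z)" for x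
      by (simp_all add: add.assoc add.left_commute)
    then show "\<forall>x. x + y \<in> boundaries W X n \<longleftrightarrow> x + z \<in> boundaries W X n"
      using boundaries_add[OF _ yz] by metis
  qed
  finally show ?thesis .
qed

lemma trivial_module_F2:
  "trivial_module (homology F2 X n) \<longleftrightarrow> cycles W X n \<subseteq> boundaries W X n"
proof -
  have "0 \<in> cycles W X n" by simp
  then have "coset n 0 \<in> coset n ` cycles W X n" by (rule imageI)
  then have "coset n ` cycles W X n = {coset n 0} \<longleftrightarrow> coset n ` cycles W X n \<subseteq> {coset n 0}"
    by (simp add: set_eq_subset)
  also have "\<dots> \<longleftrightarrow> (\<forall>z\<in>cycles W X n. coset n z = coset n 0)"
    by (simp only: image_subset_iff singleton_iff)
  finally have "coset n ` cycles W X n = {coset n 0} \<longleftrightarrow>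
    (\<forall>z\<in>cycles W X n. coset n z = coset n 0)" .
  then have "trivial_module (homology F2 X n) \<longleftrightarrow> (\<forall>z\<in>cycles W X n. coset n z = coset n 0)"
    by (simp add: trivial_module_def carrier_homology_F2 zero_homology_F2)
  then show ?thesis unfolding coset_eq_iff subset_eq by simp
qed

lemma acyclic_complex_F2: "acyclic_complex F2 X \<longleftrightarrow> mod2_acyclic W X"
  by (simp add: acyclic_complex_def mod2_acyclic_def trivial_module_F2)

lemma coset_add:
  "coset n y <+>\<^bsub>cycle_module F2 X n\<^esub> coset n z = coset n (y + z)"
proof -
  have "coset n y <+>\<^bsub>cycle_module F2 X n\<^esub> coset n z =
      {embc (u + v) |u v. u + y \<in> boundaries W X n \<and> v + z \<in> boundaries W X n}"
    by (auto simp: set_add_def set_mult_def cycle_module_def chain_module_def embc_add coset_def)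
  also have "\<dots> = embc ` {x. x + (y + z) \<in> boundaries W X n}"
  proof (intro equalityI subsetI)
    fix c assume "c \<in> {embc (u + v) |u v. u + y \<in> boundaries W X n \<and> v + z \<in> boundaries W X n}"
    then obtain u v where uv: "c = embc (u + v)" "u + y \<in> boundaries W X n" "v + z \<in> boundaries W X n"
      by blast
    have "(u + v) + (y + z) = (u + y) + (v + z)" by (simp add: algebra_simps)
    then show "c \<in> embc ` {x. x + (y + z) \<in> boundaries W X n}"
      using uv boundaries_add by (metis (mono_tags, lifting) imageI mem_Collect_eq)
  next
    fix c assume "c \<in> embc ` {x. x + (y + z) \<in> boundaries W X n}"
    then obtain x where x: "c = embc x" "x + (y + z) \<in> boundaries W X n" by blast
    have "x + z + y = x + (y + z)" by (simp add: add.assoc add.commute)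
    then have "(x + z) + y \<in> boundaries W X n" using x by metis
    moreover have "c = embc ((x + z) + z)" "z + z \<in> boundaries W X n"
      using x by (simp_all add: add.assoc)
    ultimately show "c \<in> {embc (u + v) |u v. u + y \<in> boundaries W X n \<and> v + z \<in> boundaries W X n}"
      by blast
  qed
  finally show ?thesis by (simp add: coset_def)
qed

text \<open>The action on \<open>homology\<close> is a union over all representatives; each of them
  yields the same coset, so the union collapses.\<close>

lemma coset_smult:
  assumes "a \<in> {0, 1}"
  shows "a \<odot>\<^bsub>homology F2 X n\<^esub> coset n z = coset n (if a = 0 then 0 else z)"
proof -
  have smult: "(\<lambda>\<sigma>. a * embc y \<sigma>) = embc (if a = 0 then 0 else y)" for y :: "'a set \<Rightarrow> bit"
    using assms by (auto simp: embc_zero)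
  have rcos: "boundary_chains F2 X n +>\<^bsub>cycle_module F2 X n\<^esub> embc y = coset n y" for y
    by (auto simp: a_r_coset_def r_coset_def boundary_chains_F2 coset_altdef cycle_module_def
        chain_module_def embc_add)
  have "a \<odot>\<^bsub>homology F2 X n\<^esub> coset n z =
      (\<Union>c\<in>coset n z. boundary_chains F2 X n +>\<^bsub>cycle_module F2 X n\<^esub> (\<lambda>\<sigma>. a * c \<sigma>))"
    by (simp add: homology_def Let_def cycle_module_def chain_module_def)
  also have "\<dots> = (\<Union>y\<in>{y. y + z \<in> boundaries W X n}. coset n (if a = 0 then 0 else y))"
    unfolding coset_def[of n z] by (simp add: smult rcos)
  also have "\<dots> = (\<Union>y\<in>{y. y + z \<in> boundaries W X n}. coset n (if a = 0 then 0 else z))"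
    by (intro SUP_cong refl) (auto simp: coset_eq_iff)
  also have "\<dots> = coset n (if a = 0 then 0 else z)"
  proof -
    have "z \<in> {y. y + z \<in> boundaries W X n}" by simp
    then show ?thesis by blast
  qed
  finally show ?thesis .
qed

lemma sphere_homology_F2:
  assumes "mod2_sphere W n X" shows "sphere_homology F2 n X"
proof -
  obtain z where z: "z \<in> cycles W X n" "z \<notin> boundaries W X n"
    "\<And>y. y \<in> cycles W X n \<Longrightarrow> y \<in> boundaries W X n \<or> y + z \<in> boundaries W X n"
    using assms by (auto simp: mod2_sphere_def)
  have ne: "coset n z \<noteq> coset n 0" using z by (simp add: coset_eq_iff)
  have carr: "carrier (homology F2 X n) = {coset n 0, coset n z}"
  proof -
    have "coset n y = coset n 0 \<or> coset n y = coset n z" if "y \<in> cycles W X n" for y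
      using z(1) z(3)[OF that] that by (auto simp: coset_eq_iff)
    then show ?thesis using z(1) unfolding carrier_homology_F2 by force
  qed
  \<comment> \<open>With only two classes, the isomorphism is forced: zero goes to zero.\<close>
  define \<phi> where "\<phi> K = (if K = coset n 0 then 0 else 1 :: nat)" for K
  have add: "K \<oplus>\<^bsub>homology F2 X n\<^esub> L = K <+>\<^bsub>cycle_module F2 X n\<^esub> L" for K L
    by (simp add: homology_def Let_def)
  have \<phi>: "\<phi> (coset n 0) = 0" "\<phi> (coset n z) = 1" using ne by (simp_all add: \<phi>_def)
  have cases: "K = coset n 0 \<or> K = coset n z" if "K \<in> carrier (homology F2 X n)" for K
    using that unfolding carr by simp
  have "\<phi> \<in> iso (add_monoid (homology F2 X n)) (add_monoid F2)"
  proof (rule isoI)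
    have "\<phi> (K \<oplus>\<^bsub>homology F2 X n\<^esub> L) = (\<phi> K + \<phi> L) mod 2"
      if KL: "K \<in> carrier (homology F2 X n)" "L \<in> carrier (homology F2 X n)" for K L
      using cases[OF KL(1)] cases[OF KL(2)] unfolding add
      by (elim disjE) (simp_all add: coset_add \<phi>)
    then show "\<phi> \<in> hom (add_monoid (homology F2 X n)) (add_monoid F2)"
      by (auto simp: hom_def \<phi>_def)
    show "bij_betw \<phi> (carrier (add_monoid (homology F2 X n))) (carrier (add_monoid F2))"
      unfolding bij_betw_def inj_on_def monoid.simps partial_object.simps carr
      by (simp add: \<phi>)
  qed
  moreover have "\<phi> (a \<odot>\<^bsub>homology F2 X n\<^esub> K) = a \<otimes>\<^bsub>F2\<^esub> \<phi> K"
    if aK: "a \<in> carrier F2" "K \<in> carrier (homology F2 X n)" for a K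
    using cases[OF aK(2)] aK(1) by (elim disjE) (auto simp: coset_smult \<phi>)
  ultimately have "iso_to_scalars F2 (homology F2 X n)"
    unfolding iso_to_scalars_def by blast
  then show ?thesis using assms by (auto simp: sphere_homology_def mod2_sphere_def trivial_module_F2)
qed

end

section \<open>Links under gluing a simplex\<close>

lemma down_closed_link: "down_closed X \<Longrightarrow> down_closed (link X \<sigma>)"
  unfolding down_closed_def link_def by (auto dest!: bspec) (metis Un_mono order_refl)

lemma link_subset_Pow: "X \<subseteq> Pow W \<Longrightarrow> link X \<sigma> \<subseteq> Pow W"
  by (auto simp: link_def)

lemma link_empty [simp]: "link X {} = X"
  by (simp add: link_def)

lemma link_glue_outside: "\<not> \<sigma> \<subseteq> \<Phi> \<Longrightarrow> link (Y \<union> Pow \<Phi>) \<sigma> = link Y \<sigma>"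
  by (auto simp: link_def)

text \<open>The faces added to the link are the \<open>\<tau>\<close> in
  \<open>\<alpha> \<union> \<beta>\<close>, disjoint from \<open>\<sigma>\<close>, with
  \<open>\<beta> \<subseteq> \<tau> \<union> \<sigma>\<close>. A vertex of
  \<open>\<alpha> - \<sigma>\<close> is outside \<open>\<beta>\<close>, so adding or removing it
  respects these conditions, and the matching criterion applies. The hypotheses mention only
  \<open>Y\<close> and the simplex, which allows a second use with \<open>\<alpha>\<close> and
  \<open>\<beta>\<close> exchanged.\<close>

lemma link_glue_homology:
  assumes W: "finite W" "\<alpha> \<union> \<beta> \<subseteq> W" and Y: "down_closed Y" "Y \<subseteq> Pow W"
    and disj: "\<alpha> \<inter> \<beta> = {}"
    and meet: "\<And>\<tau>. \<tau> \<subseteq> \<alpha> \<union> \<beta> \<Longrightarrow> \<tau> \<in> Y \<longleftrightarrow> \<not> \<beta> \<subseteq> \<tau>"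
    and \<sigma>: "\<sigma> \<subseteq> \<alpha> \<union> \<beta>" "\<not> \<alpha> \<subseteq> \<sigma>"
  shows "mod2_acyclic W (link Y \<sigma>) \<longleftrightarrow> mod2_acyclic W (link (Y \<union> Pow (\<alpha> \<union> \<beta>)) \<sigma>)"
    and "mod2_sphere W n (link Y \<sigma>) \<longleftrightarrow> mod2_sphere W n (link (Y \<union> Pow (\<alpha> \<union> \<beta>)) \<sigma>)"
proof -
  obtain v where v: "v \<in> \<alpha>" "v \<notin> \<sigma>" using \<sigma> by blast
  let ?X = "link (Y \<union> Pow (\<alpha> \<union> \<beta>)) \<sigma>"
  have "down_closed (Y \<union> Pow (\<alpha> \<union> \<beta>))" using Y(1) unfolding down_closed_def by blast
  then have dc: "down_closed ?X" "down_closed (link Y \<sigma>)" using Y(1) down_closed_link by blast+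
  have sub: "?X \<subseteq> Pow W" using W Y by (intro link_subset_Pow) auto
  have le: "link Y \<sigma> \<subseteq> ?X" by (auto simp: link_def)
  have diff: "\<tau> \<in> ?X - link Y \<sigma> \<longleftrightarrow> \<tau> \<inter> \<sigma> = {} \<and> \<tau> \<subseteq> \<alpha> \<union> \<beta> \<and> \<beta> \<subseteq> \<tau> \<union> \<sigma>" for \<tau>
    using meet[of "\<tau> \<union> \<sigma>"] \<sigma> by (auto simp: link_def)
  have "v \<notin> \<beta>" "v \<in> W" using v disj W by auto
  have match: "insert v \<tau> \<in> ?X - link Y \<sigma> \<longleftrightarrow> \<tau> - {v} \<in> ?X - link Y \<sigma>" for \<tau>
    unfolding diff using v \<open>v \<notin> \<beta>\<close> by blast
  show "mod2_acyclic W (link Y \<sigma>) \<longleftrightarrow> mod2_acyclic W ?X" "mod2_sphere W n (link Y \<sigma>) \<longleftrightarrow> mod2_sphere W n ?X"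
    using matched_faces_homology[OF W(1) sub \<open>v \<in> W\<close> dc le match] by blast+
qed

lemma mod2_sphere_singleton_empty:
  assumes "finite W" "W \<noteq> {}" shows "mod2_sphere W (- 1) {{}}"
proof -
  obtain v where "v \<in> W" using assms by blast
  moreover have "proper_subsets {v} = {{}}" by (auto simp: proper_subsets_def)
  ultimately show ?thesis
    using mod2_sphere_proper_subsets[OF assms(1), of "{v}"] by (simp add: face_dim_def)
qed

text \<open>Without chains in degree \<open>n + 1\<close> the only boundary is 0, so cycles are
  homology classes, and only one class is nonzero.\<close>

lemma mod2_sphere_top_cycle_unique:
  assumes "mod2_sphere W n X" "\<And>c. c \<in> chains X (n + 1) \<Longrightarrow> c = 0"
    and "y \<in> cycles W X n" "y \<noteq> 0" "z \<in> cycles W X n" "z \<noteq> 0"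
  shows "y = z"
proof -
  have B: "c = 0" if "c \<in> boundaries W X n" for c
    using that assms(2) by (force simp: boundaries_def)
  obtain x where "\<forall>y\<in>cycles W X n. y \<in> boundaries W X n \<or> y + x \<in> boundaries W X n"
    using assms(1) by (auto simp: mod2_sphere_def)
  then have "y + x = 0" "z + x = 0" using B assms by blast+
  then have "(y + x) + x = (z + x) + x" by simp
  then show ?thesis by (simp only: add.assoc chain_add_self add_0_right)
qed

section \<open>Balls and their boundary spheres under simultaneous moves\<close>

text \<open>Facets over \<open>\<tau>\<close>, selected by cardinality so that gluing a simplex
  changes them predictably; for a pure complex this agrees with \<open>facets\<close>, see
  \<open>facets_containing\<close>.\<close>

definition tops :: "nat \<Rightarrow> 'a set set \<Rightarrow> 'a set \<Rightarrow> 'a set set" where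
  "tops m B \<tau> = {\<sigma> \<in> B. card \<sigma> = m \<and> \<tau> \<subseteq> \<sigma>}"

lemma cover_insert:
  assumes "finite \<sigma>" "\<tau> \<subseteq> \<sigma>" "card \<sigma> = Suc (card \<tau>)"
  shows "\<exists>v. v \<notin> \<tau> \<and> \<sigma> = insert v \<tau>"
proof -
  have "card (\<sigma> - \<tau>) = 1" using assms by (simp add: card_Diff_subset finite_subset)
  then obtain v where "\<sigma> - \<tau> = {v}" by (auto simp: card_1_singleton_iff)
  then show ?thesis using assms(2) by (intro exI[of _ v]) auto
qed

text \<open>Here \<open>m = d + 2\<close> is the number of vertices of a facet of the ball \<open>B\<close>, and \<open>S\<close> is its boundary.\<close>

locale ball_pair =
  fixes W :: "'a set" and m k :: nat and B S :: "'a set set"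
  assumes finite_W: "finite W" and B_W: "B \<subseteq> Pow W"
    and down_B: "down_closed B" and pure_B: "\<sigma> \<in> B \<Longrightarrow> \<exists>\<tau>\<in>B. \<sigma> \<subseteq> \<tau> \<and> card \<tau> = m"
    and ridge: "\<tau> \<in> B \<Longrightarrow> Suc (card \<tau>) = m \<Longrightarrow> card (tops m B \<tau>) \<le> 2"
    and S_B: "S \<subseteq> B" and down_S: "down_closed S" and empty_S: "{} \<in> S"
    and pure_S: "\<sigma> \<in> S \<Longrightarrow> \<exists>\<tau>\<in>S. \<sigma> \<subseteq> \<tau> \<and> Suc (card \<tau>) = m"
    and ridge_S: "finite \<tau> \<Longrightarrow> Suc (card \<tau>) = m \<Longrightarrow> \<tau> \<in> S \<longleftrightarrow> card (tops m B \<tau>) = 1"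
    and stacked: "\<sigma> \<in> B \<Longrightarrow> card \<sigma> + k < m \<Longrightarrow> \<sigma> \<in> S"
    and link_S: "\<sigma> \<in> S \<Longrightarrow> mod2_sphere W (int m - 2 - int (card \<sigma>)) (link S \<sigma>)"
    and link_B: "\<sigma> \<in> S \<Longrightarrow> mod2_acyclic W (link B \<sigma>)"
    and link_interior: "\<sigma> \<in> B \<Longrightarrow> \<sigma> \<notin> S \<Longrightarrow> mod2_sphere W (int m - 1 - int (card \<sigma>)) (link B \<sigma>)"
begin

lemma finite_face: "\<sigma> \<in> B \<Longrightarrow> finite \<sigma>"
  using finite_W B_W by (meson PowD finite_subset subsetD)

lemma finite_B: "finite B"
  using finite_W B_W by (meson finite_Pow_iff finite_subset)

lemma card_B: "\<sigma> \<in> B \<Longrightarrow> card \<sigma> \<le> m"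
  using pure_B finite_face by (metis card_mono)

lemma card_S: "\<sigma> \<in> S \<Longrightarrow> card \<sigma> < m"
proof -
  assume "\<sigma> \<in> S"
  then obtain \<tau> where "\<tau> \<in> S" "\<sigma> \<subseteq> \<tau>" "Suc (card \<tau>) = m" using pure_S by blast
  then show ?thesis using card_mono[of \<tau> \<sigma>] finite_face S_B
    by (meson Suc_le_lessD Suc_le_mono order_trans subsetD eq_iff)
qed

text \<open>A ridge in two facets contributes 0 modulo 2 and a ridge in one facet contributes 1.
  Thus the sum of all facets of \<open>S\<close> is a boundary, hence a cycle;
  \<open>link_\<alpha>\<close> relies on this.\<close>

lemma bd_all_facets:
  "bd W (\<lambda>\<sigma>. of_bool (\<sigma> \<in> B \<and> card \<sigma> = m)) = (\<lambda>\<tau>. of_bool (\<tau> \<in> S \<and> Suc (card \<tau>) = m))"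
proof
  fix \<tau>
  show "bd W (\<lambda>\<sigma>. of_bool (\<sigma> \<in> B \<and> card \<sigma> = m)) \<tau> = of_bool (\<tau> \<in> S \<and> Suc (card \<tau>) = m)"
  proof (cases "finite \<tau> \<and> Suc (card \<tau>) = m")
    case True
    let ?V = "{v \<in> W - \<tau>. insert v \<tau> \<in> B}"
    have "bij_betw (\<lambda>v. insert v \<tau>) ?V (tops m B \<tau>)"
    proof (rule bij_betw_imageI)
      show "inj_on (\<lambda>v. insert v \<tau>) ?V" by (auto simp: inj_on_def)
      show "(\<lambda>v. insert v \<tau>) ` ?V = tops m B \<tau>"
      proof (intro equalityI subsetI)
        fix \<sigma> assume "\<sigma> \<in> tops m B \<tau>"
        then have \<sigma>: "\<sigma> \<in> B" "card \<sigma> = m" "\<tau> \<subseteq> \<sigma>" by (auto simp: tops_def)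
        then obtain v where "v \<notin> \<tau>" "\<sigma> = insert v \<tau>"
          using cover_insert[of \<sigma> \<tau>] True finite_face by auto
        then show "\<sigma> \<in> (\<lambda>v. insert v \<tau>) ` ?V" using \<sigma> B_W by auto
      qed (use True in \<open>auto simp: tops_def\<close>)
    qed
    then have card: "card ?V = card (tops m B \<tau>)" by (rule bij_betw_same_card)
    have "card (tops m B \<tau>) \<le> 2"
    proof (cases "\<tau> \<in> B")
      case False
      then have "tops m B \<tau> = {}" using down_closedD[OF down_B] by (auto simp: tops_def)
      then show ?thesis by simp
    qed (use ridge True in auto)
    moreover have "bd W (\<lambda>\<sigma>. of_bool (\<sigma> \<in> B \<and> card \<sigma> = m)) \<tau> = of_nat (card (tops m B \<tau>))"
    proof -
      have "bd W (\<lambda>\<sigma>. of_bool (\<sigma> \<in> B \<and> card \<sigma> = m)) \<tau> =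
          (\<Sum>v\<in>W - \<tau>. of_bool (insert v \<tau> \<in> B))"
        unfolding bd_def using True by (intro sum.cong refl) auto
      also have "\<dots> = of_nat (card ?V)"
        using finite_W by (simp add: Int_def)
      finally show ?thesis using card by simp
    qed
    moreover have "\<tau> \<in> S \<longleftrightarrow> card (tops m B \<tau>) = 1" using ridge_S True by blast
    \<comment> \<open>The bound 2 is essential here: a ridge in three facets would also have odd
      count.\<close>
    moreover have "(of_nat c :: bit) = of_bool (c = 1)" if "c \<le> 2" for c :: nat
    proof -
      from that consider "c = 0" | "c = 1" | "c = 2" by linarith
      then show ?thesis by cases auto
    qed
    ultimately show ?thesis using True by simp
  next
    case False
    have "\<not> (insert v \<tau> \<in> B \<and> card (insert v \<tau>) = m)" if "v \<in> W - \<tau>" for v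
      using False that finite_face[of "insert v \<tau>"] by auto
    then have "bd W (\<lambda>\<sigma>. of_bool (\<sigma> \<in> B \<and> card \<sigma> = m)) \<tau> = (\<Sum>v\<in>W - \<tau>. 0)"
      unfolding bd_def by (intro sum.cong refl) (simp only: of_bool_eq)
    moreover have "\<not> (\<tau> \<in> S \<and> Suc (card \<tau>) = m)"
      using False finite_face S_B by blast
    ultimately show ?thesis by simp
  qed
qed

end

text \<open>The common ground of both moves. Note that \<open>new\<close> speaks of \<open>B\<close>
  and \<open>old\<close> of \<open>S\<close>: the first is what a bistellar move on \<open>S\<close>
  leaves to be shown, the second what a shelling move on \<open>B\<close> leaves to be
  shown.\<close>

locale ball_move = ball_pair W m k B S for W :: "'a set" and m k B S +
  fixes \<alpha> \<beta> :: "'a set"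
  assumes disj: "\<alpha> \<inter> \<beta> = {}" and ne: "\<alpha> \<noteq> {}" "\<beta> \<noteq> {}" and sub_W: "\<alpha> \<union> \<beta> \<subseteq> W"
    and card_m: "card \<alpha> + card \<beta> = m" and card_k: "card \<beta> \<le> k" and new: "\<beta> \<notin> B"
    and old: "\<And>\<sigma>. \<sigma> \<subseteq> \<alpha> \<union> \<beta> \<Longrightarrow> \<not> \<beta> \<subseteq> \<sigma> \<Longrightarrow> \<sigma> \<in> S"
begin

lemma fin: "finite \<alpha>" "finite \<beta>"
  using sub_W finite_W by (auto intro: finite_subset)

lemma mem_B: "\<sigma> \<subseteq> \<alpha> \<union> \<beta> \<Longrightarrow> \<sigma> \<in> B \<longleftrightarrow> \<not> \<beta> \<subseteq> \<sigma>"
  using old S_B new down_closedD[OF down_B, of \<sigma> \<beta>] by blast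

lemma mem_S: "\<sigma> \<subseteq> \<alpha> \<union> \<beta> \<Longrightarrow> \<sigma> \<in> S \<longleftrightarrow> \<not> \<beta> \<subseteq> \<sigma>"
  using old S_B mem_B by blast

text \<open>
  The link of \<open>\<alpha>\<close> in \<open>S\<close> has a unique nonzero top-dimensional cycle, which must be both the boundary
  of \<open>\<beta>\<close> and the sum of all facets.
\<close>

lemma link_\<alpha>: assumes "\<sigma> \<in> S" "\<alpha> \<subseteq> \<sigma>" shows "\<sigma> \<subseteq> \<alpha> \<union> \<beta>"
proof -
  let ?L = "link S \<alpha>" and ?n = "int (card \<beta>) - 2"
  have \<alpha>_S: "\<alpha> \<in> S" using mem_S[of \<alpha>] disj ne by blast
  have "int m - 2 - int (card \<alpha>) = ?n" using card_m by simp
  then have mod2_sphere: "mod2_sphere W ?n ?L" using link_S[OF \<alpha>_S] by metis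
  have card_L: "card \<tau> + card \<alpha> = card (\<tau> \<union> \<alpha>)" if "\<tau> \<in> ?L" for \<tau>
  proof -
    have "finite (\<tau> \<union> \<alpha>)" using that S_B finite_face by (auto simp: link_def)
    then show ?thesis using that by (subst card_Un_disjoint) (auto simp: link_def)
  qed
  have top: "c = 0" if "c \<in> chains ?L (?n + 1)" for c
  proof -
    have False if "\<tau> \<in> ?L" "face_dim \<tau> = ?n + 1" for \<tau>
    proof -
      have "\<tau> \<union> \<alpha> \<in> S" using that by (simp add: link_def)
      then show False using card_S[of "\<tau> \<union> \<alpha>"] card_L[of \<tau>] that card_m by (simp add: face_dim_def)
    qed
    then have "c \<tau> \<noteq> 1" for \<tau> using \<open>c \<in> chains ?L (?n + 1)\<close> unfolding chains_def by blast
    then show ?thesis by (simp add: fun_eq_iff)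
  qed
  obtain b where b: "b \<in> \<beta>" using ne by blast
  define y where "y = bd W (single \<beta>)"
  have y: "y \<in> cycles W ?L ?n"
  proof -
    have "\<tau> \<in> ?L \<and> face_dim \<tau> = ?n" if y1: "y \<tau> = 1" for \<tau>
    proof -
      obtain v where v: "v \<notin> \<tau>" "\<beta> = insert v \<tau>"
        using bd_single_eq_1D[of W \<beta> \<tau>] y1 by (auto simp: y_def)
      then have "\<tau> \<union> \<alpha> \<in> S" using mem_S[of "\<tau> \<union> \<alpha>"] disj by blast
      moreover have "finite \<tau>" using v fin by simp
      ultimately show ?thesis using v disj by (auto simp: link_def face_dim_def)
    qed
    then show ?thesis using bd_bd[OF finite_W] by (simp add: cycles_def chains_def y_def)
  qed
  have y_facet: "y (\<beta> - {b}) = 1"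
    unfolding y_def using finite_W sub_W b by (intro bd_single_facet) auto
  \<comment> \<open>The chain \<open>z\<close> is the restriction of \<open>s\<close> to the link of
    \<open>\<alpha>\<close>: its boundary at \<open>\<tau>\<close> is that of \<open>s\<close> at
    \<open>\<tau> \<union> \<alpha>\<close>. As \<open>s\<close> is a cycle by
    \<open>bd_all_facets\<close>, so is \<open>z\<close>.\<close>
  define s :: "'a set \<Rightarrow> bit" where "s = (\<lambda>\<tau>. of_bool (\<tau> \<in> S \<and> Suc (card \<tau>) = m))"
  define z :: "'a set \<Rightarrow> bit" where "z = (\<lambda>\<tau>. of_bool (\<tau> \<in> ?L \<and> Suc (card \<tau>) = card \<beta>))"
  have z_s: "z \<tau> = s (\<tau> \<union> \<alpha>)" if "\<tau> \<inter> \<alpha> = {}" for \<tau>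
    using card_L[of \<tau>] card_m that by (auto simp: z_def s_def link_def)
  have "bd W z \<tau> = 0" for \<tau>
  proof (cases "\<tau> \<inter> \<alpha> = {}")
    case True
    have "bd W z \<tau> = (\<Sum>v\<in>W - (\<tau> \<union> \<alpha>). z (insert v \<tau>))"
      unfolding bd_def
      by (rule sum.mono_neutral_right) (use finite_W in \<open>auto simp: z_def link_def\<close>)
    also have "\<dots> = bd W s (\<tau> \<union> \<alpha>)"
      unfolding bd_def
    proof (intro sum.cong refl)
      fix v assume "v \<in> W - (\<tau> \<union> \<alpha>)"
      then show "z (insert v \<tau>) = s (insert v (\<tau> \<union> \<alpha>))" using z_s[of "insert v \<tau>"] True by simp
    qed
    also have "\<dots> = 0"
      using bd_bd[OF finite_W] unfolding s_def bd_all_facets[symmetric] by simp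
    finally show ?thesis .
  next
    case False
    then have "z (insert v \<tau>) = 0" for v by (auto simp: z_def link_def)
    then show ?thesis by (simp add: bd_def)
  qed
  then have z: "z \<in> cycles W ?L ?n"
    by (auto simp: cycles_def chains_def z_def face_dim_def)
  have "z (\<beta> - {b}) = 1"
  proof -
    have "(\<beta> - {b}) \<union> \<alpha> \<in> S" using mem_S[of "(\<beta> - {b}) \<union> \<alpha>"] b disj by blast
    then show ?thesis using b fin disj card_Suc_Diff1[of \<beta> b] by (auto simp: z_def link_def)
  qed
  then have "z \<noteq> 0" "y \<noteq> 0" using y_facet by auto
  then have "y = z" using mod2_sphere_top_cycle_unique[OF mod2_sphere top y _ z] by blast
  \<comment> \<open>A facet \<open>\<rho>\<close> of \<open>S\<close> through
    \<open>\<sigma>\<close> occurs in \<open>z\<close> as \<open>\<rho> - \<alpha>\<close>, hence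
    also in the boundary of \<open>\<beta>\<close>, which places it inside
    \<open>\<beta>\<close>.\<close>
  obtain \<rho> where \<rho>: "\<rho> \<in> S" "\<sigma> \<subseteq> \<rho>" "Suc (card \<rho>) = m" using pure_S assms by blast
  have "s ((\<rho> - \<alpha>) \<union> \<alpha>) = 1" using \<rho> assms by (simp add: s_def Un_absorb2 subset_trans)
  then have "y (\<rho> - \<alpha>) = 1" using z_s[of "\<rho> - \<alpha>"] \<open>y = z\<close> by auto
  then have "\<rho> - \<alpha> \<subseteq> \<beta>" using bd_single_eq_1D[of W \<beta> "\<rho> - \<alpha>"] by (auto simp: y_def)
  then show ?thesis using \<rho> by blast
qed

section \<open>Ball and sphere after the move\<close>

definition "B' = B \<union> Pow (\<alpha> \<union> \<beta>)"
definition "S' = (S - {\<sigma>. \<sigma> \<subseteq> \<alpha> \<union> \<beta> \<and> \<not> \<beta> \<subseteq> \<sigma>}) \<union> {\<sigma>. \<sigma> \<subseteq> \<alpha> \<union> \<beta> \<and> \<not> \<alpha> \<subseteq> \<sigma>}"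

lemma mem_S': "\<sigma> \<in> S' \<longleftrightarrow> (if \<sigma> \<subseteq> \<alpha> \<union> \<beta> then \<not> \<alpha> \<subseteq> \<sigma> else \<sigma> \<in> S)"
  using mem_S[of \<sigma>] by (auto simp: S'_def)

lemma card_top: "card (\<alpha> \<union> \<beta>) = m"
  using card_m fin disj by (simp add: card_Un_disjoint)

lemma card_Diff_top: "\<sigma> \<subseteq> \<alpha> \<union> \<beta> \<Longrightarrow> int (card (\<alpha> \<union> \<beta> - \<sigma>)) = int m - int (card \<sigma>)"
  using card_top fin by (metis card_Diff_subset card_mono finite_Un finite_subset of_nat_diff)

lemma down_B': "down_closed B'"
  using down_B unfolding B'_def down_closed_def by blast

text \<open>The danger is a face of \<open>S\<close> that survives outside the simplex while a
  subset containing \<open>\<alpha>\<close> is deleted; \<open>link_\<alpha>\<close> rules it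
  out.\<close>

lemma down_S': "down_closed S'"
  unfolding down_closed_def
proof (intro ballI allI impI)
  fix \<sigma> \<tau> assume \<sigma>: "\<sigma> \<in> S'" "\<tau> \<subseteq> \<sigma>"
  show "\<tau> \<in> S'"
  proof (cases "\<sigma> \<subseteq> \<alpha> \<union> \<beta>")
    case True
    then have "\<tau> \<subseteq> \<alpha> \<union> \<beta>" "\<not> \<alpha> \<subseteq> \<tau>" using \<sigma> mem_S'[of \<sigma>] by auto
    then show ?thesis by (simp add: mem_S')
  next
    case False
    then have "\<sigma> \<in> S" using \<sigma> by (simp add: mem_S')
    moreover have "\<not> \<alpha> \<subseteq> \<tau>" using link_\<alpha>[OF \<open>\<sigma> \<in> S\<close>] False \<sigma>(2) by blast
    ultimately show ?thesis using down_closedD[OF down_S _ \<sigma>(2)] by (simp add: mem_S')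
  qed
qed

lemma S'_W: "S' \<subseteq> Pow W"
  using S_B B_W sub_W by (auto simp: S'_def)

text \<open>Old and new sphere agree once the whole simplex is glued in, so links in
  \<open>S\<close> and \<open>S'\<close> can be compared through this common complex.\<close>

lemma S'_glue: "S \<union> Pow (\<alpha> \<union> \<beta>) = S' \<union> Pow (\<alpha> \<union> \<beta>)"
  by (auto simp: S'_def)

lemma tops_B': "tops m B' \<tau> = (if \<tau> \<subseteq> \<alpha> \<union> \<beta> then insert (\<alpha> \<union> \<beta>) (tops m B \<tau>) else tops m B \<tau>)"
proof -
  have "\<sigma> = \<alpha> \<union> \<beta>" if "\<sigma> \<subseteq> \<alpha> \<union> \<beta>" "card \<sigma> = m" for \<sigma>
    using that card_top fin by (simp add: card_subset_eq)
  then show ?thesis using card_top by (auto simp: tops_def B'_def)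
qed

lemma top_new: "\<alpha> \<union> \<beta> \<notin> B"
  using mem_B[of "\<alpha> \<union> \<beta>"] by simp

text \<open>A ridge of the new simplex omits one vertex. If it is in \<open>\<beta>\<close>, the
  ridge contains \<open>\<alpha>\<close>, lay on the boundary and gets its second facet; if it is in
  \<open>\<alpha>\<close>, the ridge contains \<open>\<beta>\<close> and is new.\<close>

lemma ridges_in_top:
  assumes "\<tau> \<subseteq> \<alpha> \<union> \<beta>" "Suc (card \<tau>) = m"
  shows "if \<alpha> \<subseteq> \<tau> then card (tops m B \<tau>) = 1 else tops m B \<tau> = {}"
proof -
  obtain v where v: "v \<notin> \<tau>" "\<alpha> \<union> \<beta> = insert v \<tau>"
    using cover_insert[of "\<alpha> \<union> \<beta>" \<tau>] assms card_top fin by auto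
  show ?thesis
  proof (cases "\<alpha> \<subseteq> \<tau>")
    case True
    then have "\<tau> \<in> S" using mem_S[OF assms(1)] v disj by blast
    moreover have "finite \<tau>" using assms(1) fin by (meson finite_UnI finite_subset)
    ultimately have "card (tops m B \<tau>) = 1" using ridge_S assms(2) by blast
    then show ?thesis using True by simp
  next
    case False
    then have "v \<in> \<alpha>" using v by auto
    then have "\<beta> \<subseteq> \<tau>" using v disj by auto
    then have "\<tau> \<notin> B" using mem_B[OF assms(1)] by simp
    then have "tops m B \<tau> = {}" using down_closedD[OF down_B] by (auto simp: tops_def)
    then show ?thesis using False by simp
  qed
qed

lemma finite_tops: "finite (tops m B \<tau>)"
  using finite_B by (simp add: tops_def)

lemma card_tops_B': "card (tops m B' \<tau>) = card (tops m B \<tau>) + (if \<tau> \<subseteq> \<alpha> \<union> \<beta> then 1 else 0)"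
proof -
  have "\<alpha> \<union> \<beta> \<notin> tops m B \<tau>" using top_new by (simp add: tops_def)
  then show ?thesis using finite_tops by (simp add: tops_B')
qed

lemma link_B'_new:
  assumes "\<sigma> \<subseteq> \<alpha> \<union> \<beta>" "\<beta> \<subseteq> \<sigma>"
  shows "link B' \<sigma> = Pow (\<alpha> \<union> \<beta> - \<sigma>)"
proof -
  have "\<tau> \<union> \<sigma> \<notin> B" for \<tau> using down_closedD[OF down_B, of "\<tau> \<union> \<sigma>" \<beta>] new assms by blast
  then show ?thesis using assms by (auto simp: link_def B'_def)
qed

lemma link_S'_new:
  assumes "\<sigma> \<subseteq> \<alpha> \<union> \<beta>" "\<beta> \<subseteq> \<sigma>"
  shows "link S' \<sigma> = proper_subsets (\<alpha> \<union> \<beta> - \<sigma>)"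
proof -
  have "\<tau> \<union> \<sigma> \<notin> S" for \<tau>
    using down_closedD[OF down_B, of "\<tau> \<union> \<sigma>" \<beta>] new assms S_B by blast
  then have "\<tau> \<union> \<sigma> \<in> S' \<longleftrightarrow> \<tau> \<union> \<sigma> \<subseteq> \<alpha> \<union> \<beta> \<and> \<not> \<alpha> \<subseteq> \<tau> \<union> \<sigma>" for \<tau> by (auto simp: mem_S')
  moreover have "\<tau> \<inter> \<sigma> = {} \<and> \<tau> \<union> \<sigma> \<subseteq> \<alpha> \<union> \<beta> \<and> \<not> \<alpha> \<subseteq> \<tau> \<union> \<sigma> \<longleftrightarrow> \<tau> \<subset> \<alpha> \<union> \<beta> - \<sigma>" for \<tau>
    using assms by auto
  ultimately show ?thesis by (simp add: link_def proper_subsets_def)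
qed

text \<open>Faces outside the simplex keep their links. For faces inside it, those containing
  \<open>\<beta>\<close> see only the new simplex; links of those containing neither
  \<open>\<alpha>\<close> nor \<open>\<beta>\<close> change by expansions; those containing
  \<open>\<alpha>\<close> but not \<open>\<beta>\<close> have their links in the ball capped and
  become interior.\<close>

lemma move: "ball_pair W m k B' S'"
proof
  show "finite W" by (rule finite_W)
  show "B' \<subseteq> Pow W" using B_W sub_W by (auto simp: B'_def)
  show "down_closed B'" by (rule down_B')
  show "\<exists>\<tau>\<in>B'. \<sigma> \<subseteq> \<tau> \<and> card \<tau> = m" if "\<sigma> \<in> B'" for \<sigma>
    using that pure_B card_top by (auto simp: B'_def)
  show "card (tops m B' \<tau>) \<le> 2" if "\<tau> \<in> B'" "Suc (card \<tau>) = m" for \<tau>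
  proof (cases "\<tau> \<subseteq> \<alpha> \<union> \<beta>")
    case True
    then show ?thesis using ridges_in_top[OF True that(2)] by (auto simp: card_tops_B' split: if_splits)
  next
    case False
    then have "\<tau> \<in> B" using that by (simp add: B'_def)
    then show ?thesis using ridge[OF _ that(2)] False by (simp add: card_tops_B')
  qed
  show "S' \<subseteq> B'" using S_B by (auto simp: S'_def B'_def)
  show "down_closed S'" by (rule down_S')
  show "{} \<in> S'" using ne by (simp add: mem_S')
  show "\<exists>\<tau>\<in>S'. \<sigma> \<subseteq> \<tau> \<and> Suc (card \<tau>) = m" if \<sigma>: "\<sigma> \<in> S'" for \<sigma>
  proof (cases "\<sigma> \<subseteq> \<alpha> \<union> \<beta>")
    case True
    then obtain w where w: "w \<in> \<alpha>" "w \<notin> \<sigma>" using \<sigma> by (auto simp: mem_S')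
    then have "\<alpha> \<union> \<beta> - {w} \<in> S'" "\<sigma> \<subseteq> \<alpha> \<union> \<beta> - {w}" using True by (auto simp: mem_S')
    moreover have "Suc (card (\<alpha> \<union> \<beta> - {w})) = m"
      using w fin card_top card_Suc_Diff1[of "\<alpha> \<union> \<beta>" w] by simp
    ultimately show ?thesis by blast
  next
    case False
    then have "\<sigma> \<in> S" using \<sigma> by (simp add: mem_S')
    then obtain \<tau> where \<tau>: "\<tau> \<in> S" "\<sigma> \<subseteq> \<tau>" "Suc (card \<tau>) = m" using pure_S by blast
    then have "\<tau> \<in> S'" using False by (auto simp: mem_S')
    then show ?thesis using \<tau> by blast
  qed
  show "\<tau> \<in> S' \<longleftrightarrow> card (tops m B' \<tau>) = 1" if "finite \<tau>" "Suc (card \<tau>) = m" for \<tau>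
  proof (cases "\<tau> \<subseteq> \<alpha> \<union> \<beta>")
    case True
    then show ?thesis
      using ridges_in_top[OF True that(2)] by (auto simp: card_tops_B' mem_S' split: if_splits)
  next
    case False
    then show ?thesis using ridge_S[OF that] by (simp add: card_tops_B' mem_S')
  qed
  show "\<sigma> \<in> S'" if \<sigma>: "\<sigma> \<in> B'" "card \<sigma> + k < m" for \<sigma>
  proof -
    have "\<not> \<alpha> \<subseteq> \<sigma>"
    proof
      assume "\<alpha> \<subseteq> \<sigma>"
      moreover have "finite \<sigma>" using \<sigma> finite_face fin by (auto simp: B'_def intro: finite_subset)
      ultimately have "card \<alpha> \<le> card \<sigma>" by (simp add: card_mono)
      then show False using \<sigma> card_m card_k by simp
    qed
    then show ?thesis using \<sigma> stacked[of \<sigma>] by (auto simp: mem_S' B'_def)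
  qed
  show "mod2_sphere W (int m - 2 - int (card \<sigma>)) (link S' \<sigma>)" if \<sigma>: "\<sigma> \<in> S'" for \<sigma>
  proof (cases "\<sigma> \<subseteq> \<alpha> \<union> \<beta>")
    case False
    have "\<tau> \<union> \<sigma> \<in> S' \<longleftrightarrow> \<tau> \<union> \<sigma> \<in> S" for \<tau> using False by (auto simp: mem_S')
    then have "link S' \<sigma> = link S \<sigma>" by (simp add: link_def)
    then show ?thesis using link_S \<sigma> False by (simp add: mem_S')
  next
    case True
    then have \<alpha>\<sigma>: "\<not> \<alpha> \<subseteq> \<sigma>" using \<sigma> by (simp add: mem_S')
    show ?thesis
    proof (cases "\<beta> \<subseteq> \<sigma>")
      case \<beta>\<sigma>: True
      have "mod2_sphere W (face_dim (\<alpha> \<union> \<beta> - \<sigma>) - 1) (proper_subsets (\<alpha> \<union> \<beta> - \<sigma>))"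
        using sub_W finite_W \<alpha>\<sigma> by (intro mod2_sphere_proper_subsets) auto
      moreover have "face_dim (\<alpha> \<union> \<beta> - \<sigma>) - 1 = int m - 2 - int (card \<sigma>)"
        using card_Diff_top[OF True] by (simp add: face_dim_def)
      ultimately show ?thesis by (simp only: link_S'_new[OF True \<beta>\<sigma>])
    next
      case False
      \<comment> \<open>From \<open>S\<close> up to the common complex, then down to
        \<open>S'\<close> with the roles of \<open>\<alpha>\<close> and \<open>\<beta>\<close>
        exchanged.\<close>
      have "mod2_sphere W (int m - 2 - int (card \<sigma>)) (link S \<sigma>)" using False True mem_S link_S by blast
      then have "mod2_sphere W (int m - 2 - int (card \<sigma>)) (link (S' \<union> Pow (\<beta> \<union> \<alpha>)) \<sigma>)"
        using link_glue_homology(2)[OF finite_W sub_W down_S _ disj mem_S True \<alpha>\<sigma>] S_B B_W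
        by (simp add: S'_glue Un_commute[of \<beta> \<alpha>])
      then show ?thesis
        using link_glue_homology(2)[of W \<beta> \<alpha> S' \<sigma>] finite_W sub_W down_S' S'_W disj True False
        by (simp add: mem_S' Un_commute Int_commute)
    qed
  qed
  show "mod2_acyclic W (link B' \<sigma>)" if \<sigma>: "\<sigma> \<in> S'" for \<sigma>
  proof (cases "\<sigma> \<subseteq> \<alpha> \<union> \<beta>")
    case False
    then have "link B' \<sigma> = link B \<sigma>" unfolding B'_def by (rule link_glue_outside)
    then show ?thesis using link_B \<sigma> False by (simp add: mem_S')
  next
    case True
    then have \<alpha>\<sigma>: "\<not> \<alpha> \<subseteq> \<sigma>" using \<sigma> by (simp add: mem_S')
    show ?thesis
    proof (cases "\<beta> \<subseteq> \<sigma>")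
      case \<beta>\<sigma>: True
      show ?thesis
        unfolding link_B'_new[OF True \<beta>\<sigma>] using finite_W sub_W \<alpha>\<sigma> by (intro mod2_acyclic_Pow) auto
    next
      case False
      then have "mod2_acyclic W (link B \<sigma>)" using True mem_S link_B by blast
      then show ?thesis
        unfolding B'_def
        using link_glue_homology(1)[OF finite_W sub_W down_B B_W disj mem_B True \<alpha>\<sigma>] by simp
    qed
  qed
  show "mod2_sphere W (int m - 1 - int (card \<sigma>)) (link B' \<sigma>)" if \<sigma>: "\<sigma> \<in> B'" "\<sigma> \<notin> S'" for \<sigma>
  proof (cases "\<sigma> \<subseteq> \<alpha> \<union> \<beta>")
    case False
    then have "link B' \<sigma> = link B \<sigma>" unfolding B'_def by (rule link_glue_outside)
    then show ?thesis using link_interior \<sigma> False by (auto simp: mem_S' B'_def)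
  next
    case True
    then have \<alpha>\<sigma>: "\<alpha> \<subseteq> \<sigma>" using \<sigma> by (simp add: mem_S')
    show ?thesis
    proof (cases "\<beta> \<subseteq> \<sigma>")
      case \<beta>\<sigma>: True
      then have "\<sigma> = \<alpha> \<union> \<beta>" using \<alpha>\<sigma> True by blast
      moreover have "W \<noteq> {}" using ne sub_W by blast
      ultimately show ?thesis
        using link_B'_new[OF True \<beta>\<sigma>] mod2_sphere_singleton_empty finite_W card_top by simp
    next
      case False
      let ?b = "\<alpha> \<union> \<beta> - \<sigma>"
      \<comment> \<open>As \<open>\<sigma>\<close> already contains \<open>\<alpha>\<close>, a new
        face of its link must complete \<open>\<sigma>\<close> to the whole simplex, so exactly one
        face is added.\<close>
      have eq: "link B' \<sigma> = insert ?b (link B \<sigma>)"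
      proof (intro equalityI subsetI)
        fix \<tau> assume \<tau>: "\<tau> \<in> link B' \<sigma>"
        show "\<tau> \<in> insert ?b (link B \<sigma>)"
        proof (cases "\<tau> \<union> \<sigma> \<in> B")
          case False
          then have "\<tau> \<union> \<sigma> \<subseteq> \<alpha> \<union> \<beta>" "\<tau> \<inter> \<sigma> = {}" using \<tau> by (auto simp: link_def B'_def)
          moreover have "\<beta> \<subseteq> \<tau> \<union> \<sigma>" using False mem_B calculation by blast
          ultimately have "\<tau> = ?b" using \<alpha>\<sigma> by blast
          then show ?thesis by simp
        qed (use \<tau> in \<open>auto simp: link_def\<close>)
      qed (use True in \<open>auto simp: link_def B'_def\<close>)
      have "?b \<union> \<sigma> = \<alpha> \<union> \<beta>" using True by blast
      then have "?b \<notin> link B \<sigma>" using top_new by (simp add: link_def)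
      moreover have "proper_subsets ?b \<subseteq> link B \<sigma>"
      proof
        fix \<tau> assume "\<tau> \<in> proper_subsets ?b"
        then have "\<tau> \<subset> ?b" by (simp add: proper_subsets_def)
        then have "\<tau> \<inter> \<sigma> = {}" "\<tau> \<union> \<sigma> \<subseteq> \<alpha> \<union> \<beta>" "\<not> \<beta> \<subseteq> \<tau> \<union> \<sigma>" using True \<alpha>\<sigma> by blast+
        then show "\<tau> \<in> link B \<sigma>" using mem_B by (simp add: link_def)
      qed
      moreover have "mod2_acyclic W (link B \<sigma>)" using False True mem_S link_B by blast
      moreover have "insert ?b (link B \<sigma>) \<subseteq> Pow W"
        using sub_W link_subset_Pow[OF B_W] by blast
      ultimately have "mod2_sphere W (face_dim ?b) (link B' \<sigma>)"
        unfolding eq using finite_W down_closed_link[OF down_B] False True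
        by (intro mod2_sphere_insert_face) auto
      then show ?thesis using card_Diff_top[OF True] by (simp add: face_dim_def algebra_simps)
    qed
  qed
qed

end

text \<open>The start of both inductions. Stackedness holds for every \<open>k\<close>, since the
  only interior face is \<open>V\<close> itself.\<close>

lemma ball_pair_simplex:
  assumes "finite W" "V \<subseteq> W" "card V = m" "V \<noteq> {}"
  shows "ball_pair W m k (Pow V) (proper_subsets V)"
proof
  have fin: "finite V" using assms finite_subset by blast
  have tops: "tops m (Pow V) \<tau> = (if \<tau> \<subseteq> V then {V} else {})" for \<tau>
    using card_subset_eq[OF fin] assms(3) by (auto simp: tops_def)
  have card: "int (card (V - \<sigma>)) = int m - int (card \<sigma>)" if "\<sigma> \<subseteq> V" for \<sigma>
    using that fin assms(3) by (metis card_Diff_subset card_mono finite_subset of_nat_diff)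
  have link_Pow: "link (Pow V) \<sigma> = Pow (V - \<sigma>)" if "\<sigma> \<subseteq> V" for \<sigma>
    using that by (auto simp: link_def)
  have link_proper: "link (proper_subsets V) \<sigma> = proper_subsets (V - \<sigma>)" if "\<sigma> \<subseteq> V" for \<sigma>
    using that unfolding link_def proper_subsets_def by blast
  show "finite W" by fact
  show "Pow V \<subseteq> Pow W" using assms by auto
  show "down_closed (Pow V)" by (auto simp: down_closed_def)
  show "\<exists>\<tau>\<in>Pow V. \<sigma> \<subseteq> \<tau> \<and> card \<tau> = m" if "\<sigma> \<in> Pow V" for \<sigma> using that assms by auto
  show "card (tops m (Pow V) \<tau>) \<le> 2" for \<tau> by (simp add: tops)
  show "proper_subsets V \<subseteq> Pow V" by (auto simp: proper_subsets_def)
  show "down_closed (proper_subsets V)" by (auto simp: down_closed_def proper_subsets_def)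
  show "{} \<in> proper_subsets V" using assms by (auto simp: proper_subsets_def)
  show "\<exists>\<tau>\<in>proper_subsets V. \<sigma> \<subseteq> \<tau> \<and> Suc (card \<tau>) = m" if \<sigma>: "\<sigma> \<in> proper_subsets V" for \<sigma>
  proof -
    obtain v where "v \<in> V" "v \<notin> \<sigma>" "\<sigma> \<subseteq> V" using \<sigma> by (auto simp: proper_subsets_def)
    then show ?thesis
      using fin assms(3) card_Suc_Diff1[of V v]
      by (intro bexI[of _ "V - {v}"]) (auto simp: proper_subsets_def)
  qed
  show "\<tau> \<in> proper_subsets V \<longleftrightarrow> card (tops m (Pow V) \<tau>) = 1" if "Suc (card \<tau>) = m" for \<tau>
    using that assms(3) by (auto simp: tops proper_subsets_def)
  show "\<sigma> \<in> proper_subsets V" if "\<sigma> \<in> Pow V" "card \<sigma> + k < m" for \<sigma>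
    using that assms(3) by (auto simp: proper_subsets_def)
  show "mod2_sphere W (int m - 2 - int (card \<sigma>)) (link (proper_subsets V) \<sigma>)"
    if "\<sigma> \<in> proper_subsets V" for \<sigma>
  proof -
    have \<sigma>: "\<sigma> \<subseteq> V" "V - \<sigma> \<noteq> {}" using that by (auto simp: proper_subsets_def)
    then have "mod2_sphere W (face_dim (V - \<sigma>) - 1) (proper_subsets (V - \<sigma>))"
      using assms by (intro mod2_sphere_proper_subsets) auto
    moreover have "face_dim (V - \<sigma>) - 1 = int m - 2 - int (card \<sigma>)"
      using card[OF \<sigma>(1)] by (simp add: face_dim_def)
    ultimately show ?thesis by (simp only: link_proper[OF \<sigma>(1)])
  qed
  show "mod2_acyclic W (link (Pow V) \<sigma>)" if "\<sigma> \<in> proper_subsets V" for \<sigma>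
  proof -
    have \<sigma>: "\<sigma> \<subseteq> V" "V - \<sigma> \<noteq> {}" using that by (auto simp: proper_subsets_def)
    then show ?thesis unfolding link_Pow[OF \<sigma>(1)] using assms by (intro mod2_acyclic_Pow) auto
  qed
  show "mod2_sphere W (int m - 1 - int (card \<sigma>)) (link (Pow V) \<sigma>)"
    if "\<sigma> \<in> Pow V" "\<sigma> \<notin> proper_subsets V" for \<sigma>
  proof -
    have "\<sigma> = V" using that by (auto simp: proper_subsets_def)
    moreover have "W \<noteq> {}" using assms by blast
    ultimately show ?thesis using link_Pow[of V] mod2_sphere_singleton_empty assms by simp
  qed
qed

section \<open>Enlarging the vertex set\<close>

context
  fixes W W' :: "'a set" and X :: "'a set set"
  assumes W: "W \<subseteq> W'" "finite W'" "X \<subseteq> Pow W"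
begin

lemma bd_enlarge: assumes "c \<in> chains X n" shows "bd W' c = bd W c"
proof
  fix \<tau>
  have "c (insert v \<tau>) = 0" if "v \<in> (W' - \<tau>) - (W - \<tau>)" for v
  proof -
    have "insert v \<tau> \<notin> X" using that W by auto
    then show ?thesis using assms by (auto simp: chains_def)
  qed
  then show "bd W' c \<tau> = bd W c \<tau>"
    unfolding bd_def using W by (intro sum.mono_neutral_right) auto
qed

lemma cycles_enlarge: "cycles W' X n = cycles W X n"
  using bd_enlarge by (auto simp: cycles_def)

lemma boundaries_enlarge: "boundaries W' X n = boundaries W X n"
  using bd_enlarge by (auto simp: boundaries_def)

lemma mod2_acyclic_enlarge: "mod2_acyclic W' X \<longleftrightarrow> mod2_acyclic W X"
  by (simp add: mod2_acyclic_def cycles_enlarge boundaries_enlarge)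

lemma mod2_sphere_enlarge: "mod2_sphere W' n X \<longleftrightarrow> mod2_sphere W n X"
  by (simp add: mod2_sphere_def cycles_enlarge boundaries_enlarge)

end

text \<open>When \<open>\<beta>\<close> is a single new vertex it may lie outside the ambient set,
  which therefore has to grow before the move.\<close>

lemma ball_pair_enlarge:
  assumes "ball_pair W m k B S" "W \<subseteq> W'" "finite W'"
  shows "ball_pair W' m k B S"
proof -
  interpret ball_pair W m k B S by fact
  have S_W: "S \<subseteq> Pow W" using S_B B_W by blast
  show ?thesis
    using assms(2,3) B_W down_B pure_B ridge S_B down_S empty_S pure_S ridge_S stacked link_S link_B
      link_interior
    by unfold_locales
      (auto simp: mod2_sphere_enlarge[OF assms(2,3)] mod2_acyclic_enlarge[OF assms(2,3)] link_subset_Pow[OF B_W]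
        link_subset_Pow[OF S_W])
qed

section \<open>Bistellar moves and shelling moves\<close>

lemma cjoin_Pow_proper:
  "\<alpha> \<inter> \<beta> = {} \<Longrightarrow> cjoin (Pow \<alpha>) (proper_subsets \<beta>) = {\<sigma>. \<sigma> \<subseteq> \<alpha> \<union> \<beta> \<and> \<not> \<beta> \<subseteq> \<sigma>}"
proof (intro equalityI subsetI)
  fix \<sigma> assume "\<sigma> \<in> {\<sigma>. \<sigma> \<subseteq> \<alpha> \<union> \<beta> \<and> \<not> \<beta> \<subseteq> \<sigma>}"
  then have "\<sigma> = (\<sigma> \<inter> \<alpha>) \<union> (\<sigma> \<inter> \<beta>)" "\<sigma> \<inter> \<alpha> \<in> Pow \<alpha>" "\<sigma> \<inter> \<beta> \<in> proper_subsets \<beta>"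
    by (auto simp: proper_subsets_def)
  then show "\<sigma> \<in> cjoin (Pow \<alpha>) (proper_subsets \<beta>)" unfolding cjoin_def by blast
qed (auto simp: cjoin_def proper_subsets_def)

lemma cjoin_commute: "cjoin X Y = cjoin Y X"
  unfolding cjoin_def by (rule Collect_cong) (metis Un_commute)

lemma cjoin_proper_Pow:
  "\<alpha> \<inter> \<beta> = {} \<Longrightarrow> cjoin (proper_subsets \<alpha>) (Pow \<beta>) = {\<sigma>. \<sigma> \<subseteq> \<alpha> \<union> \<beta> \<and> \<not> \<alpha> \<subseteq> \<sigma>}"
  using cjoin_Pow_proper[of \<beta> \<alpha>] by (simp add: cjoin_commute[of "proper_subsets \<alpha>"] Un_commute Int_commute)

lemma complex_dim_eqI:
  assumes "finite X" "\<sigma> \<in> X" "\<And>\<tau>. \<tau> \<in> X \<Longrightarrow> card \<tau> \<le> card \<sigma>"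
  shows "complex_dim X = face_dim \<sigma>"
  unfolding complex_dim_def
proof (rule Max_eqI)
  show "n \<le> face_dim \<sigma>" if "n \<in> face_dim ` X" for n
    using that assms(3) by (force simp: face_dim_def)
qed (use assms in auto)

section \<open>Dimension, facets and boundary of a ball pair\<close>

context ball_pair
begin

lemma empty_B: "{} \<in> B"
  using empty_S S_B by blast

lemma finite_S: "finite S"
  using S_B finite_B finite_subset by blast

lemma simplicial_B: "simplicial_complex B"
  using finite_B empty_B finite_face down_closedD[OF down_B] by (auto simp: simplicial_complex_def)

lemma simplicial_S: "simplicial_complex S"
  using finite_S empty_S finite_face S_B down_closedD[OF down_S]
  by (auto simp: simplicial_complex_def)

lemma complex_dim_B: "complex_dim B = int m - 1"
proof -
  obtain \<sigma> where "\<sigma> \<in> B" "card \<sigma> = m" using pure_B[OF empty_B] by blast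
  then show ?thesis
    using complex_dim_eqI[OF finite_B, of \<sigma>] card_B by (simp add: face_dim_def)
qed

lemma complex_dim_S: "complex_dim S = int m - 2"
proof -
  obtain \<sigma> where \<sigma>: "\<sigma> \<in> S" "Suc (card \<sigma>) = m" using pure_S[OF empty_S] by blast
  moreover have "card \<tau> \<le> card \<sigma>" if "\<tau> \<in> S" for \<tau> using card_S[OF that] \<sigma> by simp
  ultimately show ?thesis
    using complex_dim_eqI[OF finite_S, of \<sigma>] by (auto simp: face_dim_def)
qed

lemma facets_B: "facets B = {\<sigma> \<in> B. card \<sigma> = m}"
proof (intro equalityI subsetI)
  fix \<sigma> assume "\<sigma> \<in> facets B"
  then show "\<sigma> \<in> {\<sigma> \<in> B. card \<sigma> = m}" using pure_B[of \<sigma>] by (auto simp: facets_def)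
next
  fix \<sigma> assume \<sigma>: "\<sigma> \<in> {\<sigma> \<in> B. card \<sigma> = m}"
  have "\<tau> = \<sigma>" if "\<tau> \<in> B" "\<sigma> \<subseteq> \<tau>" for \<tau>
    using card_subset_eq[OF finite_face[OF that(1)] that(2)] card_B[OF that(1)] \<sigma>
      card_mono[OF finite_face[OF that(1)] that(2)] by simp
  then show "\<sigma> \<in> facets B" using \<sigma> by (auto simp: facets_def)
qed

lemma facets_containing: "{\<sigma> \<in> facets B. \<tau> \<subseteq> \<sigma>} = tops m B \<tau>"
  by (auto simp: facets_B tops_def)

lemma ridge_dim: "face_dim \<tau> = complex_dim B - 1 \<longleftrightarrow> Suc (card \<tau>) = m"
  by (auto simp: complex_dim_B face_dim_def)

lemma pure_complex_B: "pure_complex B"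
  using simplicial_B by (auto simp: pure_complex_def facets_B complex_dim_B face_dim_def)

lemma weak_pseudomanifold_B: "weak_pseudomanifold B"
  using pure_complex_B ridge
  by (simp add: weak_pseudomanifold_def facets_containing ridge_dim)

text \<open>Both sides are generated by the ridges in exactly one facet, because \<open>S\<close> is
  pure.\<close>

lemma pm_boundary_B: "pm_boundary B = S"
proof (intro equalityI subsetI)
  fix \<rho> assume "\<rho> \<in> pm_boundary B"
  then obtain \<tau> where \<tau>: "\<tau> \<in> B" "Suc (card \<tau>) = m" "card (tops m B \<tau>) = 1" "\<rho> \<subseteq> \<tau>"
    by (auto simp: pm_boundary_def facets_containing ridge_dim)
  then have "\<tau> \<in> S" using ridge_S finite_face by blast
  then show "\<rho> \<in> S" using down_closedD[OF down_S] \<tau> by blast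
next
  fix \<rho> assume "\<rho> \<in> S"
  then obtain \<tau> where \<tau>: "\<tau> \<in> S" "\<rho> \<subseteq> \<tau>" "Suc (card \<tau>) = m" using pure_S by blast
  then have "\<tau> \<in> B" "card (tops m B \<tau>) = 1" using S_B ridge_S finite_face by blast+
  then show "\<rho> \<in> pm_boundary B"
    unfolding pm_boundary_def facets_containing ridge_dim using \<tau> by blast
qed

end

section \<open>The move seen as a bistellar and as a shelling move\<close>

context ball_move
begin

sublocale moved: ball_pair W m k B' S'
  by (rule move)

lemma bistellar_step_S: "bistellar_step k S S'"
proof -
  have "induced S (\<alpha> \<union> \<beta>) = {\<sigma>. \<sigma> \<subseteq> \<alpha> \<union> \<beta> \<and> \<not> \<beta> \<subseteq> \<sigma>}"
    using mem_S by (auto simp: induced_def)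
  then have "bistellar_move \<alpha> \<beta> S S'"
    using simplicial_S fin ne disj card_m
    by (auto simp: bistellar_move_def cjoin_Pow_proper cjoin_proper_Pow S'_def complex_dim_S face_dim_def)
  then show ?thesis using card_k unfolding bistellar_step_def face_dim_def by force
qed

lemma shelling_step_B: "shelling_step k B B'"
proof -
  have "induced B (\<alpha> \<union> \<beta>) = {\<sigma>. \<sigma> \<subseteq> \<alpha> \<union> \<beta> \<and> \<not> \<beta> \<subseteq> \<sigma>}"
    using mem_B by (auto simp: induced_def)
  moreover have "facets B' - facets B = {\<alpha> \<union> \<beta>}"
  proof -
    \<comment> \<open>Over the empty face, \<open>tops\<close> lists all facets.\<close>
    have "tops m B' {} = insert (\<alpha> \<union> \<beta>) (tops m B {})" using tops_B'[of "{}"] by simp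
    moreover have "\<alpha> \<union> \<beta> \<notin> tops m B {}" using top_new by (simp add: tops_def)
    ultimately have "tops m B' {} - tops m B {} = {\<alpha> \<union> \<beta>}" by auto
    then show ?thesis by (simp add: facets_containing[of "{}", simplified]
        moved.facets_containing[of "{}", simplified])
  qed
  ultimately have "shelling_move \<alpha> \<beta> B B'"
    using pure_complex_B moved.pure_complex_B disj ne complex_dim_B moved.complex_dim_B
    by (auto simp: shelling_move_def cjoin_Pow_proper B'_def)
  then show ?thesis using card_k unfolding shelling_step_def face_dim_def by force
qed

text \<open>Connectivity of the dual graph persists because the new simplex shares the ridge
  \<open>\<alpha> \<union> \<beta> - {b}\<close>, for \<open>b \<in> \<beta>\<close>, with an old
  facet.\<close>

lemma pseudomanifold_B':
  assumes "pseudomanifold B" shows "pseudomanifold B'"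
proof -
  have facets: "facets B' = insert (\<alpha> \<union> \<beta>) (facets B)"
    using tops_B'[of "{}"] facets_containing[of "{}"] moved.facets_containing[of "{}"] by simp
  have mono: "dual_edges B \<subseteq> dual_edges B'"
    by (auto simp: dual_edges_def facets complex_dim_B moved.complex_dim_B)
  obtain b where b: "b \<in> \<beta>" using ne by blast
  then have "\<alpha> \<union> \<beta> - {b} \<in> B" using mem_B[of "\<alpha> \<union> \<beta> - {b}"] by blast
  then obtain \<rho> where \<rho>: "\<rho> \<in> B" "\<alpha> \<union> \<beta> - {b} \<subseteq> \<rho>" "card \<rho> = m" using pure_B by blast
  have "\<rho> \<in> facets B" using \<rho> by (simp add: facets_B)
  have "\<not> \<alpha> \<union> \<beta> \<subseteq> \<rho>" using down_closedD[OF down_B \<rho>(1)] new by blast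
  then have "\<rho> \<inter> (\<alpha> \<union> \<beta>) = \<alpha> \<union> \<beta> - {b}" using \<rho> by blast
  moreover have "Suc (card (\<alpha> \<union> \<beta> - {b})) = m"
    using b fin card_top card_Suc_Diff1[of "\<alpha> \<union> \<beta>" b] by simp
  ultimately have edge: "(\<rho>, \<alpha> \<union> \<beta>) \<in> dual_edges B'" "(\<alpha> \<union> \<beta>, \<rho>) \<in> dual_edges B'"
    using \<open>\<rho> \<in> facets B\<close> moved.ridge_dim
    by (auto simp: dual_edges_def facets Int_commute[of "\<alpha> \<union> \<beta>" \<rho>])
  have "(\<sigma>, \<rho>) \<in> (dual_edges B')\<^sup>* \<and> (\<rho>, \<sigma>) \<in> (dual_edges B')\<^sup>*" if "\<sigma> \<in> facets B'" for \<sigma>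
  proof (cases "\<sigma> = \<alpha> \<union> \<beta>")
    case False
    then have "\<sigma> \<in> facets B" using that facets by blast
    then show ?thesis
      using assms \<open>\<rho> \<in> facets B\<close> rtrancl_mono[OF mono] unfolding pseudomanifold_def by blast
  qed (use edge in auto)
  then show ?thesis
    unfolding pseudomanifold_def using moved.weak_pseudomanifold_B by (meson rtrancl_trans)
qed

end

section \<open>Induction along sequences of moves\<close>

lemma pseudomanifold_simplex:
  assumes "finite V" "V \<noteq> {}" shows "pseudomanifold (Pow V)"
proof -
  interpret ball_pair V "card V" 0 "Pow V" "proper_subsets V"
    by (rule ball_pair_simplex) (use assms in auto)
  have "facets (Pow V) = {V}" by (auto simp: facets_def)
  then show ?thesis using weak_pseudomanifold_B by (simp add: pseudomanifold_def)
qed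

lemma ball_of_stellated:
  assumes "(bistellar_step k)\<^sup>*\<^sup>* (proper_subsets V) S"
    and V: "finite V" "V \<noteq> {}" "card V = m" and k: "2 * k < m"
  shows "\<exists>W B. ball_pair W m k B S \<and> (shelling_step k)\<^sup>*\<^sup>* (Pow V) B \<and> pseudomanifold B"
  using assms(1)
proof induction
  case base
  then show ?case using ball_pair_simplex[of V V m k] pseudomanifold_simplex V by blast
next
  case (step S T)
  then obtain W B where B: "ball_pair W m k B S" "(shelling_step k)\<^sup>*\<^sup>* (Pow V) B" "pseudomanifold B"
    by blast
  obtain \<alpha> \<beta> where \<alpha>\<beta>: "bistellar_move \<alpha> \<beta> S T" and \<beta>: "card \<beta> \<le> k"
    using step.hyps(2) by (auto simp: bistellar_step_def face_dim_def)
  have disj: "\<alpha> \<inter> \<beta> = {}" and ne: "\<alpha> \<noteq> {}" "\<beta> \<noteq> {}" and fin: "finite \<alpha>" "finite \<beta>"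
    and T: "T = (S - {\<sigma>. \<sigma> \<subseteq> \<alpha> \<union> \<beta> \<and> \<not> \<beta> \<subseteq> \<sigma>}) \<union> {\<sigma>. \<sigma> \<subseteq> \<alpha> \<union> \<beta> \<and> \<not> \<alpha> \<subseteq> \<sigma>}"
    and ind: "induced S (\<alpha> \<union> \<beta>) = {\<sigma>. \<sigma> \<subseteq> \<alpha> \<union> \<beta> \<and> \<not> \<beta> \<subseteq> \<sigma>}"
    and dim: "face_dim \<alpha> + face_dim \<beta> = complex_dim S"
    using \<alpha>\<beta> by (auto simp: bistellar_move_def cjoin_Pow_proper cjoin_proper_Pow)
  define W' where "W' = W \<union> \<alpha> \<union> \<beta>"
  have "finite W" using B(1) ball_pair.finite_W by blast
  then interpret ball_pair W' m k B S
    by (intro ball_pair_enlarge[OF B(1)]) (auto simp: W'_def fin)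
  have "\<beta> \<notin> S" using ind by (auto simp: induced_def)
  \<comment> \<open>Here the dimension bound enters:
    \<open>card \<beta> + k \<le> 2 * k < m\<close>, so a face \<open>\<beta>\<close> of
    \<open>B\<close> would lie in \<open>S\<close> by \<open>stacked\<close>.\<close>
  then have "\<beta> \<notin> B" using stacked[of \<beta>] \<beta> k by auto
  moreover have "card \<alpha> + card \<beta> = m" using dim by (simp add: complex_dim_S face_dim_def)
  moreover have "\<sigma> \<in> S" if "\<sigma> \<subseteq> \<alpha> \<union> \<beta>" "\<not> \<beta> \<subseteq> \<sigma>" for \<sigma>
    using ind that by (auto simp: induced_def)
  ultimately interpret ball_move W' m k B S \<alpha> \<beta>
    using disj ne \<beta> by unfold_locales (auto simp: W'_def)
  have "T = S'" by (simp add: T S'_def)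
  then show ?case
    using move pseudomanifold_B' B shelling_step_B by (meson rtranclp.rtrancl_into_rtrancl)
qed

text \<open>The definition only compares facets; every face of the finite complex \<open>X\<close>
  lies in one of them, either in \<open>Y\<close> or the new one.\<close>

lemma shelling_move_eq:
  assumes "shelling_move \<alpha> \<beta> Y X"
  shows "X = Y \<union> Pow (\<alpha> \<union> \<beta>)"
proof (intro equalityI subsetI)
  have sc: "simplicial_complex X" and sub: "Y \<subseteq> X" and fac: "facets X - facets Y = {\<alpha> \<union> \<beta>}"
    and scY: "simplicial_complex Y"
    using assms by (auto simp: shelling_move_def pure_complex_def)
  {
    fix \<sigma> assume "\<sigma> \<in> X"
    have "finite {\<tau> \<in> X. \<sigma> \<subseteq> \<tau>}" "{\<tau> \<in> X. \<sigma> \<subseteq> \<tau>} \<noteq> {}"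
      using sc \<open>\<sigma> \<in> X\<close> by (auto simp: simplicial_complex_def)
    then obtain \<rho> where "\<rho> \<in> {\<tau> \<in> X. \<sigma> \<subseteq> \<tau>}" "\<forall>\<tau>\<in>{\<tau> \<in> X. \<sigma> \<subseteq> \<tau>}. \<rho> \<subseteq> \<tau> \<longrightarrow> \<rho> = \<tau>"
      by (rule finite_has_maximal[THEN bexE])
    then have "\<rho> \<in> facets X" "\<sigma> \<subseteq> \<rho>" by (auto simp: facets_def)
    then have "\<rho> \<in> Y \<or> \<rho> = \<alpha> \<union> \<beta>" using fac by (auto simp: facets_def)
    then show "\<sigma> \<in> Y \<union> Pow (\<alpha> \<union> \<beta>)"
      using scY \<open>\<sigma> \<subseteq> \<rho>\<close> by (auto simp: simplicial_complex_def)
  next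
    fix \<sigma> assume "\<sigma> \<in> Y \<union> Pow (\<alpha> \<union> \<beta>)"
    moreover have "\<alpha> \<union> \<beta> \<in> X" using fac by (auto simp: facets_def)
    ultimately show "\<sigma> \<in> X" using sub sc by (auto simp: simplicial_complex_def)
  }
qed

lemma facets_mono_pure:
  assumes "pure_complex X" "pure_complex Y" "complex_dim X = complex_dim Y" "Y \<subseteq> X"
  shows "facets Y \<subseteq> facets X"
proof
  fix \<sigma> assume \<sigma>: "\<sigma> \<in> facets Y"
  have "\<tau> = \<sigma>" if \<tau>: "\<tau> \<in> X" "\<sigma> \<subseteq> \<tau>" for \<tau>
  proof -
    have X: "finite X" "finite \<tau>"
      using assms(1) \<tau> by (auto simp: pure_complex_def simplicial_complex_def)
    have "face_dim \<tau> \<le> complex_dim X" unfolding complex_dim_def using X \<tau> by (intro Max_ge) auto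
    also have "\<dots> = face_dim \<sigma>" using assms \<sigma> by (simp add: pure_complex_def)
    finally show ?thesis
      using card_seteq[OF X(2) \<tau>(2)] by (simp add: face_dim_def)
  qed
  then show "\<sigma> \<in> facets X" using \<sigma> assms(4) by (auto simp: facets_def)
qed

text \<open>Facets of \<open>Y\<close> stay facets in \<open>X\<close> as the dimensions agree, so
  ridge counts can only grow. Only the final ball of a shelling is assumed to be a pseudomanifold,
  and this passes the ridge condition back to the earlier ones.\<close>

lemma weak_pseudomanifold_shelling:
  assumes "shelling_move \<alpha> \<beta> Y X" "weak_pseudomanifold X"
  shows "weak_pseudomanifold Y"
proof -
  have Y: "pure_complex X" "pure_complex Y" "complex_dim X = complex_dim Y" "Y \<subseteq> X"
    using assms(1) by (auto simp: shelling_move_def)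
  have "finite (facets X)"
    using Y(1) by (auto simp: pure_complex_def simplicial_complex_def facets_def)
  then have le: "card {\<sigma> \<in> facets Y. \<tau> \<subseteq> \<sigma>} \<le> card {\<sigma> \<in> facets X. \<tau> \<subseteq> \<sigma>}" for \<tau>
    using facets_mono_pure[OF Y] by (intro card_mono) auto
  show ?thesis
    using assms(2) Y order_trans[OF le] unfolding weak_pseudomanifold_def by auto
qed

lemma sphere_of_shelled:
  assumes "(shelling_step k)\<^sup>*\<^sup>* (Pow V) B" "weak_pseudomanifold B"
    and V: "finite V" "V \<noteq> {}" "card V = m" and k: "k < m"
  shows "\<exists>W S. ball_pair W m k B S \<and> (bistellar_step k)\<^sup>*\<^sup>* (proper_subsets V) S"
  using assms(1,2)
proof induction
  case base
  then show ?case using ball_pair_simplex[of V V m k] V by blast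
next
  case (step Y X)
  obtain \<alpha> \<beta> where \<alpha>\<beta>: "shelling_move \<alpha> \<beta> Y X" and \<beta>: "card \<beta> \<le> k"
    using step.hyps(2) by (auto simp: shelling_step_def face_dim_def)
  obtain W S where S: "ball_pair W m k Y S" "(bistellar_step k)\<^sup>*\<^sup>* (proper_subsets V) S"
    using step.IH weak_pseudomanifold_shelling[OF \<alpha>\<beta> step.prems] by blast
  have disj: "\<alpha> \<inter> \<beta> = {}" and ne: "\<beta> \<noteq> {}" and fin: "finite \<alpha>" "finite \<beta>"
    and ind: "induced Y (\<alpha> \<union> \<beta>) = {\<sigma>. \<sigma> \<subseteq> \<alpha> \<union> \<beta> \<and> \<not> \<beta> \<subseteq> \<sigma>}"
    and dim: "complex_dim X = complex_dim Y" and pure: "pure_complex X" "pure_complex Y" "Y \<subseteq> X"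
    and fac: "facets X - facets Y = {\<alpha> \<union> \<beta>}"
    using \<alpha>\<beta> by (auto simp: shelling_move_def pure_complex_def simplicial_complex_def cjoin_Pow_proper)
  define W' where "W' = W \<union> \<alpha> \<union> \<beta>"
  have "finite W" using S(1) ball_pair.finite_W by blast
  then interpret ball_pair W' m k Y S
    by (intro ball_pair_enlarge[OF S(1)]) (auto simp: W'_def fin)
  have "face_dim (\<alpha> \<union> \<beta>) = complex_dim X" using fac pure(1) by (auto simp: pure_complex_def)
  then have card: "card (\<alpha> \<union> \<beta>) = m" by (simp add: dim complex_dim_B face_dim_def)
  then have card_m: "card \<alpha> + card \<beta> = m" using fin disj by (simp add: card_Un_disjoint)
  \<comment> \<open>An empty \<open>\<alpha>\<close> would close the ball up to a sphere; then
    \<open>card \<beta>\<close> would be \<open>m\<close>, more than \<open>k\<close>.\<close>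
  then have "\<alpha> \<noteq> {}" using \<beta> k by auto
  have "\<beta> \<notin> Y" using ind by (auto simp: induced_def)
  \<comment> \<open>Each such face lies in a ridge \<open>\<alpha> \<union> \<beta> - {b}\<close>.
    In \<open>X\<close> this ridge has at most two facets, one of them new; by purity of
    \<open>Y\<close> at least one is old. So it has exactly one facet in \<open>Y\<close>, which
    puts it on the boundary.\<close>
  have "\<sigma> \<in> S" if \<sigma>: "\<sigma> \<subseteq> \<alpha> \<union> \<beta>" "\<not> \<beta> \<subseteq> \<sigma>" for \<sigma>
  proof -
    obtain b where b: "b \<in> \<beta>" "b \<notin> \<sigma>" using \<sigma> by blast
    let ?\<tau> = "\<alpha> \<union> \<beta> - {b}"
    have \<tau>: "?\<tau> \<in> Y" using ind b by (auto simp: induced_def)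
    have card_\<tau>: "Suc (card ?\<tau>) = m"
      using b fin card card_Suc_Diff1[of "\<alpha> \<union> \<beta>" b] by simp
    have "finite (facets X)"
      using pure(1) by (auto simp: pure_complex_def simplicial_complex_def facets_def)
    moreover have "insert (\<alpha> \<union> \<beta>) (tops m Y ?\<tau>) \<subseteq> {\<sigma> \<in> facets X. ?\<tau> \<subseteq> \<sigma>}"
      using facets_mono_pure[OF pure(1,2) dim pure(3)] fac unfolding facets_containing[symmetric]
      by blast
    ultimately have "card (insert (\<alpha> \<union> \<beta>) (tops m Y ?\<tau>)) \<le> card {\<sigma> \<in> facets X. ?\<tau> \<subseteq> \<sigma>}"
      by (intro card_mono) auto
    also have "\<dots> \<le> 2"
      using step.prems \<tau> pure(3) ridge_dim[of ?\<tau>] card_\<tau>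
      unfolding weak_pseudomanifold_def dim by blast
    finally have "card (insert (\<alpha> \<union> \<beta>) (tops m Y ?\<tau>)) \<le> 2" .
    moreover have "\<alpha> \<union> \<beta> \<notin> tops m Y ?\<tau>"
      using down_closedD[OF down_B, of "\<alpha> \<union> \<beta>" \<beta>] \<open>\<beta> \<notin> Y\<close> by (auto simp: tops_def)
    moreover have fin_tops: "finite (tops m Y ?\<tau>)" using finite_B by (simp add: tops_def)
    ultimately have "card (tops m Y ?\<tau>) \<le> 1" by simp
    moreover have "tops m Y ?\<tau> \<noteq> {}" using pure_B[OF \<tau>] by (auto simp: tops_def)
    then have "card (tops m Y ?\<tau>) \<noteq> 0" using fin_tops by simp
    ultimately have "?\<tau> \<in> S" using ridge_S[OF finite_face[OF \<tau>] card_\<tau>] by simp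
    then show "\<sigma> \<in> S" using down_closedD[OF down_S] \<sigma> b by (metis Diff_empty subset_Diff_insert)
  qed
  then interpret ball_move W' m k Y S \<alpha> \<beta>
    using disj ne \<open>\<alpha> \<noteq> {}\<close> \<beta> card_m \<open>\<beta> \<notin> Y\<close> by unfold_locales (auto simp: W'_def)
  have "X = B'" unfolding B'_def by (rule shelling_move_eq[OF \<alpha>\<beta>])
  then show ?case
    using move S bistellar_step_S by (meson rtranclp.rtrancl_into_rtrancl)
qed

section \<open>From ball pairs to stacked spheres\<close>

lemma mod2_sphere_not_acyclic: "mod2_sphere W n X \<Longrightarrow> \<not> mod2_acyclic W X"
  by (auto simp: mod2_sphere_def mod2_acyclic_def)

text \<open>Acyclic links single out exactly \<open>S\<close>, because the links of interior faces
  have nonzero homology. Hence the homological boundary and \<open>pm_boundary\<close>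
  coincide.\<close>

lemma stacked_sphere_of_ball_pair:
  fixes S :: "'a::linorder set set"
  assumes "ball_pair W m k B S"
  shows "stacked_sphere TYPE(nat) k (int m - 2) S"
proof -
  interpret ball_pair W m k B S by fact
  have S_W: "S \<subseteq> Pow W" using S_B B_W by blast
  have ac: "acyclic_complex F2 (link B \<sigma>) \<longleftrightarrow> mod2_acyclic W (link B \<sigma>)" for \<sigma>
    using acyclic_complex_F2[OF finite_W link_subset_Pow[OF B_W] down_closed_link[OF down_B]] .
  have bdry: "homology_ball_boundary F2 B = S"
    using S_B link_B link_interior mod2_sphere_not_acyclic unfolding homology_ball_boundary_def ac by blast
  have sphere: "homology_sphere_over F2 (int m - 2) S"
    unfolding homology_sphere_over_def
  proof (intro conjI ballI)
    fix \<sigma> assume "\<sigma> \<in> S"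
    then have "sphere_homology F2 (int m - 2 - int (card \<sigma>)) (link S \<sigma>)"
      using sphere_homology_F2[OF finite_W link_subset_Pow[OF S_W] down_closed_link[OF down_S]] link_S
      by blast
    then show "sphere_homology F2 (int m - 2 - face_dim \<sigma> - 1) (link S \<sigma>)"
      by (simp add: face_dim_def algebra_simps)
  qed (simp_all add: simplicial_S complex_dim_S)
  have "sphere_homology F2 (int m - 2 + 1 - face_dim \<sigma> - 1) (link B \<sigma>) \<or> acyclic_complex F2 (link B \<sigma>)"
    if \<sigma>: "\<sigma> \<in> B" for \<sigma>
  proof (cases "\<sigma> \<in> S")
    case False
    then have "sphere_homology F2 (int m - 1 - int (card \<sigma>)) (link B \<sigma>)"
      using sphere_homology_F2[OF finite_W link_subset_Pow[OF B_W] down_closed_link[OF down_B]]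
        link_interior \<sigma> by blast
    then show ?thesis by (simp add: face_dim_def algebra_simps)
  qed (use link_B ac in blast)
  moreover have "acyclic_complex F2 B" using ac[of "{}"] link_B[OF empty_S] by simp
  ultimately have "homology_ball_over F2 (int m - 2 + 1) B"
    using sphere simplicial_B complex_dim_B by (simp add: homology_ball_over_def bdry)
  moreover have "\<sigma> \<in> S" if "\<sigma> \<in> B" "int m - 2 + 1 - face_dim \<sigma> \<ge> int k + 1" for \<sigma>
    using that stacked[of \<sigma>] by (simp add: face_dim_def)
  ultimately have "stacked_ball_over F2 k (int m - 2 + 1) B"
    by (simp add: stacked_ball_over_def bdry)
  then show ?thesis
    unfolding stacked_sphere_def homology_sphere_def using field_F2 sphere bdry by blast
qed

lemma stellated_ball_pair:
  assumes "stellated k d S" "d \<ge> 2 * int k - 1"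
  obtains W B where "ball_pair W (nat (d + 2)) k B S" "shelled k (d + 1) B"
proof -
  obtain V where V: "finite V" "face_dim V = d + 1" "(bistellar_step k)\<^sup>*\<^sup>* (proper_subsets V) S"
    using assms(1) by (auto simp: stellated_def standard_sphere_def)
  \<comment> \<open>Since \<open>k\<close> is a natural number, the bound gives
    \<open>d \<ge> -1\<close>: the conversion by \<open>nat\<close> loses nothing, and
    \<open>V\<close> has at least one vertex.\<close>
  have card: "card V = nat (d + 2)" "V \<noteq> {}" using V(2) assms(2) by (auto simp: face_dim_def)
  have "2 * k < nat (d + 2)" using assms(2) by linarith
  then obtain W B where B: "ball_pair W (nat (d + 2)) k B S" "(shelling_step k)\<^sup>*\<^sup>* (Pow V) B"
    "pseudomanifold B"
    using ball_of_stellated[OF V(3,1) card(2,1)] by blast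
  have "complex_dim B = d + 1" using ball_pair.complex_dim_B[OF B(1)] assms(2) by simp
  moreover have "standard_ball (d + 1) (Pow V)" using V by (auto simp: standard_ball_def)
  ultimately have "shelled k (d + 1) B" using B assms(2) by (auto simp: shelled_def)
  then show ?thesis using that B by blast
qed

lemma stellated_pm_boundary:
  assumes "shelled k (d + 1) B" "d \<ge> 2 * int k - 1"
  shows "stellated k d (pm_boundary B)"
proof -
  obtain V where V: "finite V" "face_dim V = d + 1" "(shelling_step k)\<^sup>*\<^sup>* (Pow V) B"
    and "weak_pseudomanifold B"
    using assms(1) by (auto simp: shelled_def standard_ball_def pseudomanifold_def)
  have card: "card V = nat (d + 2)" "V \<noteq> {}" using V(2) assms(2) by (auto simp: face_dim_def)
  have "k < nat (d + 2)" using assms(2) by linarith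
  then obtain W S where S: "ball_pair W (nat (d + 2)) k B S" "(bistellar_step k)\<^sup>*\<^sup>* (proper_subsets V) S"
    using sphere_of_shelled[OF V(3) \<open>weak_pseudomanifold B\<close> V(1) card(2,1)] by blast
  interpret ball_pair W "nat (d + 2)" k B S by (rule S(1))
  have "standard_sphere d (proper_subsets V)" using V by (auto simp: standard_sphere_def)
  then show ?thesis
    using S(2) simplicial_S complex_dim_S assms(2) unfolding pm_boundary_B stellated_def by auto
qed

theorem theorem2p9:
  fixes k :: nat
  shows "(\<forall>(d::int) (S :: 'a::linorder set set).
            homology_sphere TYPE('f) d S \<and> d \<ge> 2 * int k - 1 \<longrightarrow>
            (stellated k d S \<longleftrightarrow> (\<exists>B. shelled k (d + 1) B \<and> S = pm_boundary B)))
       \<and> (\<forall>(d::int) (S :: 'a::linorder set set).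
            d \<ge> 2 * int k - 1 \<and> stellated k d S \<longrightarrow> stacked_sphere TYPE(nat) k d S)"
proof (intro conjI allI impI; elim conjE)
  fix d and S :: "'a set set"
  assume d: "d \<ge> 2 * int k - 1"
  show "stellated k d S \<longleftrightarrow> (\<exists>B. shelled k (d + 1) B \<and> S = pm_boundary B)"
  proof
    assume "stellated k d S"
    then show "\<exists>B. shelled k (d + 1) B \<and> S = pm_boundary B"
      using d ball_pair.pm_boundary_B by (metis stellated_ball_pair)
  next
    assume "\<exists>B. shelled k (d + 1) B \<and> S = pm_boundary B"
    then show "stellated k d S" using stellated_pm_boundary d by blast
  qed
next
  fix d and S :: "'a set set"
  assume d: "d \<ge> 2 * int k - 1" and "stellated k d S"
  then obtain W B where "ball_pair W (nat (d + 2)) k B S" by (metis stellated_ball_pair)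
  then have "stacked_sphere TYPE(nat) k (int (nat (d + 2)) - 2) S"
    by (rule stacked_sphere_of_ball_pair)
  then show "stacked_sphere TYPE(nat) k d S" using d by simp
qed

end
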